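(* Let $\mathbb{G}=V_1\oplus\cdots\oplus V_\iota$ be a stratified group of dimension $n$ and let $d$ be a homogeneous distance on $\mathbb{G}$ such that the corresponding closed unit ball $\mathbb{B}(0,1)$ is convex. Then for every $v\in V_1\setminus\{0\}$, $$\beta(d,v)=\mathcal{H}^{n-1}\big(N(v)\cap\mathbb{B}(0,1)\big).$$
   Context: **Stratified group.** $\mathbb{G}=V_1\oplus\cdots\oplus V_\iota$ is a graded finite-dimensional real vector space of dimension $n$, with a simply connected nilpotent Lie group structure given by the Baker-Campbell-Hausdorff product (the group is identified with its Lie algebra through the exponential map, with unit $0$). Its Lie algebra of left invariant vector fields is graded, $\mathcal{G}=\mathcal{V}_1\oplus\cdots\oplus\mathcal{V}_\iota$, where $\mathcal{V}_j$ consists of the left invariant fields whose value at $0$ lies in $V_j$. It satisfies $[\mathcal{V}_1,\mathcal{V}_j]=\mathcal{V}_{j+1}$ for all $j\ge1$, with $\mathcal{V}_i=\{0\}$ for $i>\iota$ and $V_\iota\ne\{0\}$. The dilations are $\delta_r(v)=r^jv$ for $v\in V_j$, $r>0$, extended linearly. **Homogeneous distance.** A continuous left invariant distance $d$ on $\mathbb{G}$ with $d(\delta_rx,\delta_ry)=r\,d(x,y)$ for all $x,y\in\mathbb{G}$, $r>0$. Closed balls are $\mathbb{B}(y,r)=\{z:d(z,y)\le r\}$. Convexity of $\mathbb{B}(0,1)$ is meant in the vector space $\mathbb{G}$. **Scalar product and $\beta$.** A basis of $\mathbb{G}$ adapted to the grading (consecutive blocks are bases of $V_1,\dots,V_\iota$)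 is fixed, together with the scalar product making it orthonormal. $\mathcal{H}^{n-1}$ is the $(n-1)$-dimensional Hausdorff measure with respect to the corresponding Euclidean distance, normalized to agree with Lebesgue measure on $(n-1)$-dimensional linear subspaces. For $\nu\in V_1\setminus\{0\}$ the vertical subgroup is $N(\nu)=\nu^\bot\oplus V_2\oplus\cdots\oplus V_\iota$, where $\nu^\bot$ is the orthogonal complement of $\nu$ in $V_1$, and $$\beta(d,\nu)=\max_{z\in\mathbb{B}(0,1)}\mathcal{H}^{n-1}\big(\mathbb{B}(z,1)\cap N(\nu)\big).$$ *)

theory Defs
  imports "HOL-Analysis.Analysis"
begin

subsection \<open>Stratified groups\<close>

text \<open>
  The group is identified with its Lie algebra through the exponential map: the underlying
  vector space \<^typ>\<open>'a\<close> carries a Lie bracket \<open>br\<close>, and the group law is the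
  Baker-Campbell-Hausdorff product of \<open>br\<close>, with unit \<open>0\<close>. The value of a left invariant
  field at \<open>0\<close> identifies the Lie algebra of left invariant fields with \<open>('a, br)\<close>, so the
  conditions on its layers are stated for \<open>br\<close> and the layers \<open>V j\<close>. Only the values \<open>V j\<close>
  with \<open>j \<ge> 1\<close> are meaningful.
\<close>

locale stratified_group =
  fixes V :: "nat \<Rightarrow> 'a::euclidean_space set"
    and \<iota> :: nat
    and br :: "'a \<Rightarrow> 'a \<Rightarrow> 'a"
  assumes bilinear_br: "bilinear br"
    and alternating_br: "br x x = 0"
    and jacobi: "br x (br y z) + br y (br z x) + br z (br x y) = 0"
    and subspace_layer: "1 \<le> j \<Longrightarrow> subspace (V j)"
    and direct_sum: "\<exists>!c. (\<forall>j. if j \<in> {1..\<iota>} then c j \<in> V j else c j = 0) \<and> x = (\<Sum>j=1..\<iota>. c j)"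
    and layer_beyond: "\<iota> < j \<Longrightarrow> V j = {0}"
    and last_layer: "1 \<le> \<iota>" "V \<iota> \<noteq> {0}"
    and layer_Suc: "1 \<le> j \<Longrightarrow> span {br x y | x y. x \<in> V 1 \<and> y \<in> V j} = V (Suc j)"

text \<open>Right-nested brackets: \<open>nested_bracket br [x\<^sub>1, \<dots>, x\<^sub>k] = [x\<^sub>1, [x\<^sub>2, \<dots> [x\<^sub>k\<^sub>-\<^sub>1, x\<^sub>k]]]\<close>.\<close>

fun nested_bracket :: "('a::zero \<Rightarrow> 'a \<Rightarrow> 'a) \<Rightarrow> 'a list \<Rightarrow> 'a" where
  "nested_bracket br [] = 0"
| "nested_bracket br [x] = x"
| "nested_bracket br (x # y # zs) = br x (nested_bracket br (y # zs))"

text \<open>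
  Dynkin's form of the Baker-Campbell-Hausdorff series
  \[ \sum_{k \ge 1} \frac{(-1)^{k-1}}{k} \sum_{r_i + s_i > 0}
     \frac{[x^{r_1} y^{s_1} \cdots x^{r_k} y^{s_k}]}{\sum_i (r_i + s_i) \, \prod_i r_i! \, s_i!}, \]
  where a list \<open>ps\<close> encodes \<open>[(r\<^sub>1, s\<^sub>1), \<dots>, (r\<^sub>k, s\<^sub>k)]\<close>. In a Lie algebra that is nilpotent of
  step \<open>\<iota>\<close>, the terms of total degree greater than \<open>\<iota>\<close> vanish; the sum is restricted to the
  finitely many remaining ones.
\<close>

definition bch :: "nat \<Rightarrow> ('a::real_vector \<Rightarrow> 'a \<Rightarrow> 'a) \<Rightarrow> 'a \<Rightarrow> 'a \<Rightarrow> 'a" where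
  "bch \<iota> br x y =
    (\<Sum>ps | ps \<noteq> [] \<and> (\<forall>(r, s) \<in> set ps. 0 < r + s) \<and> (\<Sum>(r, s)\<leftarrow>ps. r + s) \<le> \<iota>.
      ((-1) ^ (length ps - 1) /
        (real (length ps) * real (\<Sum>(r, s)\<leftarrow>ps. r + s) * (\<Prod>(r, s)\<leftarrow>ps. fact r * fact s))) *\<^sub>R
      nested_bracket br (concat (map (\<lambda>(r, s). replicate r x @ replicate s y) ps)))"

definition dilation :: "(nat \<Rightarrow> 'a::real_vector set) \<Rightarrow> nat \<Rightarrow> real \<Rightarrow> 'a \<Rightarrow> 'a" where
  "dilation V \<iota> r = (THE f. linear f \<and> (\<forall>j\<in>{1..\<iota>}. \<forall>v\<in>V j. f v = r ^ j *\<^sub>R v))"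

subsection \<open>Homogeneous distances\<close>

definition homogeneous_distance ::
  "(nat \<Rightarrow> 'a::euclidean_space set) \<Rightarrow> nat \<Rightarrow> ('a \<Rightarrow> 'a \<Rightarrow> 'a) \<Rightarrow> ('a \<Rightarrow> 'a \<Rightarrow> real) \<Rightarrow> bool" where
  "homogeneous_distance V \<iota> br d \<longleftrightarrow>
    Metric_space UNIV d \<and>
    continuous_on UNIV (\<lambda>(x, y). d x y) \<and>
    (\<forall>z x y. d (bch \<iota> br z x) (bch \<iota> br z y) = d x y) \<and>
    (\<forall>r>0. \<forall>x y. d (dilation V \<iota> r x) (dilation V \<iota> r y) = r * d x y)"

abbreviation hball :: "('a \<Rightarrow> 'a \<Rightarrow> real) \<Rightarrow> 'a \<Rightarrow> real \<Rightarrow> 'a set" where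
  "hball d \<equiv> Metric_space.mcball UNIV d"

subsection \<open>Scalar product and Hausdorff measure\<close>

text \<open>
  \<open>B 1, \<dots>, B \<iota>\<close> are the blocks of a basis adapted to the grading; the scalar product of the
  type \<^typ>\<open>'a\<close> is the one that makes this basis orthonormal.
\<close>

definition adapted_orthonormal_basis ::
  "(nat \<Rightarrow> 'a::euclidean_space set) \<Rightarrow> nat \<Rightarrow> (nat \<Rightarrow> 'a set) \<Rightarrow> bool" where
  "adapted_orthonormal_basis V \<iota> B \<longleftrightarrow>
    (\<forall>j\<in>{1..\<iota>}. independent (B j) \<and> span (B j) = V j) \<and>
    (\<forall>b\<in>\<Union>(B ` {1..\<iota>}). \<forall>b'\<in>\<Union>(B ` {1..\<iota>}). b \<bullet> b' = (if b = b' then 1 else 0))"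

text \<open>
  The factor \<open>unit_ball_vol k / 2 ^ k\<close> (volume of the \<open>k\<close>-dimensional ball of diameter 1) is the
  standard normalization for which the \<open>k\<close>-dimensional Hausdorff measure coincides with Lebesgue
  measure on \<open>k\<close>-dimensional subspaces, by the isodiametric inequality. Empty members of a cover
  contribute \<open>0\<close> also for \<open>k = 0\<close>, where \<open>0 ^ 0 = 1\<close>. Covers are required to be bounded because
  \<^const>\<open>diameter\<close> is unspecified on unbounded sets.
\<close>

definition hausdorff_content :: "nat \<Rightarrow> real \<Rightarrow> 'a::metric_space set \<Rightarrow> ennreal" where
  "hausdorff_content k \<delta> A =
    (INF C \<in> {C :: nat \<Rightarrow> 'a set. A \<subseteq> (\<Union>i. C i) \<and> (\<forall>i. bounded (C i) \<and> diameter (C i) \<le> \<delta>)}.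
      \<Sum>i. if C i = {} then 0 else ennreal (unit_ball_vol (real k) / 2 ^ k * diameter (C i) ^ k))"

definition hausdorff_measure :: "nat \<Rightarrow> 'a::metric_space set \<Rightarrow> ennreal" where
  "hausdorff_measure k A = (SUP \<delta>\<in>{0<..}. hausdorff_content k \<delta> A)"

subsection \<open>Vertical subgroups and the function \<open>\<beta>\<close>\<close>

definition vertical_subgroup :: "(nat \<Rightarrow> 'a::euclidean_space set) \<Rightarrow> nat \<Rightarrow> 'a \<Rightarrow> 'a set" where
  "vertical_subgroup V \<iota> \<nu> =
    {u + w | u w. u \<in> V 1 \<and> u \<bullet> \<nu> = 0 \<and> w \<in> span (\<Union>j\<in>{2..\<iota>}. V j)}"

text \<open>
  \<open>GREATEST\<close> denotes the maximum: an equation for \<open>beta\<close> can only be derived by showing that the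
  maximum is attained.
\<close>

definition beta ::
  "(nat \<Rightarrow> 'a::euclidean_space set) \<Rightarrow> nat \<Rightarrow> ('a \<Rightarrow> 'a \<Rightarrow> real) \<Rightarrow> 'a \<Rightarrow> ennreal" where
  "beta V \<iota> d \<nu> =
    (GREATEST m. \<exists>z\<in>hball d 0 1.
      m = hausdorff_measure (DIM('a) - 1) (hball d z 1 \<inter> vertical_subgroup V \<iota> \<nu>))"

end

theory Submission
  imports Defs
begin

text \<open>
  By left invariance, \<open>B(z, 1) \<inter> N(v)\<close> is the image under the left translation by \<open>z\<close> of a slice of
  \<open>B(0, 1)\<close> by an affine hyperplane parallel to \<open>N(v)\<close>. In coordinates adapted to the grading the
  translation is triangular with unit diagonal, so it preserves volume. The ball \<open>B(0, 1)\<close> is a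
  compact convex set, symmetric because the group inverse is \<open>x \<mapsto> - x\<close>; the average of the slices at
  heights \<open>t\<close> and \<open>- t\<close> lies in the central slice, so by the Brunn-Minkowski inequality the central
  slice is the largest. On a hyperplane only the proportionality of \<open>H\<^sup>n\<^sup>-\<^sup>1\<close> to Lebesgue
  measure matters, not the value of the constant; this avoids the isodiametric inequality.
\<close>

subsection \<open>Hausdorff measure on coordinate hyperplanes\<close>

text \<open>A left translation is not a Euclidean isometry, so nothing can be said directly about
  its effect on Hausdorff measure. Slices are therefore compared by volume: a flat set
  \<open>E\<close> orthogonal to a unit vector \<open>e\<close> is thickened to the cylinder E +
  [0, 1] e, and its Hausdorff measure is c times the volume of this cylinder, where c is the measure
  of the unit flat cube. Every comparison carries the same finite c, and both Brunn-Minkowski and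
  the change of variables take place for Lebesgue measure on the whole space. The direction v / |v|
  need not belong to the given adapted basis. What is taken from that basis is the orthogonality of
  the layers; a new orthonormal basis of layer vectors containing v / |v| is then identified with
  \<open>Basis\<close>. Triangularity comes from the filtration \<open>tail\<close>: each bracket
  moves at least one layer up, so a perturbation in layer j affects the nonlinear part of the
  product only above j. Brunn-Minkowski is used as |A| |C| \<le> |D|^2, with D containing all
  midpoints. This form has no exponent depending on the dimension, so it passes through an induction
  on the number of coordinates.\<close>

definition cover_cost :: "nat \<Rightarrow> 'a::metric_space set \<Rightarrow> ennreal" where
  "cover_cost k X = (if X = {} then 0 else ennreal (unit_ball_vol (real k) / 2 ^ k * diameter X ^ k))"

lemma cover_cost_empty [simp]: "cover_cost k {} = 0"
  by (simp add: cover_cost_def)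

lemma hausdorff_content_alt:
  "hausdorff_content k \<delta> A =
    (INF C \<in> {C :: nat \<Rightarrow> 'a::metric_space set. A \<subseteq> (\<Union>i. C i) \<and> (\<forall>i. bounded (C i) \<and> diameter (C i) \<le> \<delta>)}.
      \<Sum>i. cover_cost k (C i))"
  unfolding hausdorff_content_def cover_cost_def ..

lemma hausdorff_content_le:
  assumes "A \<subseteq> (\<Union>i. C i)" "\<And>i. bounded (C i)" "\<And>i. diameter (C i) \<le> \<delta>"
  shows "hausdorff_content k \<delta> A \<le> (\<Sum>i. cover_cost k (C i))"
  unfolding hausdorff_content_alt by (rule INF_lower) (use assms in auto)

text \<open>A finite family is padded to a sequence by empty sets, which cost 0 even for
  \<open>k = 0\<close>. The hypothesis \<open>0 \<le> \<delta>\<close> admits these members, whose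
  diameter is 0.\<close>

lemma hausdorff_content_le_finite:
  fixes A :: "'a::metric_space set"
  assumes "finite I" "A \<subseteq> (\<Union>i\<in>I. C i)" "\<And>i. i \<in> I \<Longrightarrow> bounded (C i)"
    "\<And>i. i \<in> I \<Longrightarrow> diameter (C i) \<le> \<delta>" "0 \<le> \<delta>"
  shows "hausdorff_content k \<delta> A \<le> (\<Sum>i\<in>I. cover_cost k (C i))"
proof -
  obtain g where g: "bij_betw g {..<card I} I"
    using ex_bij_betw_nat_finite[OF assms(1)] by (auto simp: atLeast0LessThan)
  define D where "D = (\<lambda>n. if n < card I then C (g n) else {})"
  have gI: "n < card I \<Longrightarrow> g n \<in> I" for n
    using g by (auto simp: bij_betw_def)
  have "A \<subseteq> (\<Union>n. D n)"
  proof
    fix x assume "x \<in> A"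
    then obtain i where "i \<in> I" "x \<in> C i" using assms by auto
    moreover then obtain n where "n < card I" "i = g n"
      using g by (auto simp: bij_betw_def)
    ultimately show "x \<in> (\<Union>n. D n)" by (auto simp: D_def intro!: exI[of _ n])
  qed
  then have "hausdorff_content k \<delta> A \<le> (\<Sum>n. cover_cost k (D n))"
    by (rule hausdorff_content_le) (use assms gI in \<open>auto simp: D_def\<close>)
  also have "\<dots> = (\<Sum>n<card I. cover_cost k (D n))"
    by (rule suminf_finite) (auto simp: D_def)
  also have "\<dots> = (\<Sum>n<card I. cover_cost k (C (g n)))"
    by (simp add: D_def)
  also have "\<dots> = (\<Sum>i\<in>I. cover_cost k (C i))"
    by (rule sum.reindex_bij_betw[OF g])
  finally show ?thesis .
qed

lemma hausdorff_content_mono: "A \<subseteq> B \<Longrightarrow> hausdorff_content k \<delta> A \<le> hausdorff_content k \<delta> B"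
  unfolding hausdorff_content_alt by (rule INF_superset_mono) auto

lemma hausdorff_measure_mono: "A \<subseteq> B \<Longrightarrow> hausdorff_measure k A \<le> hausdorff_measure k B"
  unfolding hausdorff_measure_def by (intro SUP_mono) (use hausdorff_content_mono in blast)

text \<open>Near-optimal covers of the sets \<open>E i\<close>, with errors e / 2^(i+1) of total e,
  are merged into one sequence by \<open>prod_decode\<close>. The right-hand side may be assumed
  finite, so each content is finite and can be strictly exceeded by adding its error.\<close>

lemma hausdorff_content_UN:
  fixes E :: "nat \<Rightarrow> 'a::metric_space set"
  shows "hausdorff_content k \<delta> (\<Union>i. E i) \<le> (\<Sum>i. hausdorff_content k \<delta> (E i))"
proof (rule ennreal_le_epsilon)
  fix e :: real assume e: "0 < e" and fin: "(\<Sum>i. hausdorff_content k \<delta> (E i)) < top"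
  have "\<exists>C. E i \<subseteq> (\<Union>j. C j) \<and> (\<forall>j. bounded (C j) \<and> diameter (C j) \<le> \<delta>) \<and>
      (\<Sum>j. cover_cost k (C j)) \<le> hausdorff_content k \<delta> (E i) + ennreal (e * (1/2) ^ Suc i)" for i
  proof -
    have "hausdorff_content k \<delta> (E i) \<noteq> \<infinity>"
      using ennreal_suminf_lessD[OF fin, of i] by (auto simp: less_top)
    moreover have "0 < ennreal (e * (1/2) ^ Suc i)" using e by simp
    ultimately have "hausdorff_content k \<delta> (E i) < hausdorff_content k \<delta> (E i) + ennreal (e * (1/2) ^ Suc i)"
      by (metis ennreal_add_left_cancel_less add.right_neutral infinity_ennreal_def)
    then show ?thesis
      apply (subst (asm) (1) hausdorff_content_alt)
      apply (auto simp: INF_less_iff intro: less_imp_le)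
      done
  qed
  then obtain C where C: "\<And>i. E i \<subseteq> (\<Union>j. C i j)" "\<And>i j. bounded (C i j)" "\<And>i j. diameter (C i j) \<le> \<delta>"
    "\<And>i. (\<Sum>j. cover_cost k (C i j)) \<le> hausdorff_content k \<delta> (E i) + ennreal (e * (1/2) ^ Suc i)"
    by metis
  have "(\<Union>i. E i) \<subseteq> (\<Union>n. case_prod C (prod_decode n))"
  proof
    fix x assume "x \<in> (\<Union>i. E i)"
    then obtain i j where "x \<in> C i j" using C(1) by blast
    then show "x \<in> (\<Union>n. case_prod C (prod_decode n))"
      by (auto intro!: exI[of _ "prod_encode (i, j)"])
  qed
  then have "hausdorff_content k \<delta> (\<Union>i. E i) \<le> (\<Sum>n. cover_cost k (case_prod C (prod_decode n)))"
    by (rule hausdorff_content_le) (use C in \<open>auto split: prod.split\<close>)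
  also have "\<dots> = (\<Sum>i. \<Sum>j. cover_cost k (C i j))"
    by (rule suminf_ennreal_2dimen[of _ "\<lambda>p. cover_cost k (case_prod C p)"]) simp
  also have "\<dots> \<le> (\<Sum>i. hausdorff_content k \<delta> (E i) + ennreal (e * (1/2) ^ Suc i))"
    by (intro suminf_le C) auto
  also have "\<dots> = (\<Sum>i. hausdorff_content k \<delta> (E i)) + (\<Sum>i. ennreal (e * (1/2) ^ Suc i))"
    by (rule suminf_add[symmetric]) auto
  also have "(\<Sum>i. ennreal (e * (1/2) ^ Suc i)) = ennreal (\<Sum>i. e * (1/2) ^ Suc i)"
    using e by (intro suminf_ennreal2 summable_mult sums_summable[OF power_half_series]) auto
  also have "(\<Sum>i. e * (1/2) ^ Suc i) = e"
    using sums_mult[OF power_half_series, of e] by (simp add: sums_iff)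
  finally show "hausdorff_content k \<delta> (\<Union>i. E i) \<le> (\<Sum>i. hausdorff_content k \<delta> (E i)) + ennreal e" .
qed

lemma hausdorff_content_le_measure: "0 < \<delta> \<Longrightarrow> hausdorff_content k \<delta> A \<le> hausdorff_measure k A"
  unfolding hausdorff_measure_def by (rule SUP_upper) auto

lemma hausdorff_measure_UN:
  fixes E :: "nat \<Rightarrow> 'a::metric_space set"
  shows "hausdorff_measure k (\<Union>i. E i) \<le> (\<Sum>i. hausdorff_measure k (E i))"
  unfolding hausdorff_measure_def[of k "\<Union>i. E i"]
proof (rule SUP_least)
  fix \<delta> :: real assume "\<delta> \<in> {0<..}"
  then have "(\<Sum>i. hausdorff_content k \<delta> (E i)) \<le> (\<Sum>i. hausdorff_measure k (E i))"
    by (intro suminf_le hausdorff_content_le_measure) auto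
  with hausdorff_content_UN show "hausdorff_content k \<delta> (\<Union>i. E i) \<le> (\<Sum>i. hausdorff_measure k (E i))"
    by (rule order_trans)
qed

lemma hausdorff_measure_empty [simp]: "hausdorff_measure k {} = 0"
proof -
  have "hausdorff_content k \<delta> {} \<le> 0" if "\<delta> > 0" for \<delta>
    using hausdorff_content_le[of "{}" "\<lambda>_. {}" \<delta> k] that by simp
  then show ?thesis
    unfolding hausdorff_measure_def by (metis (no_types, lifting) SUP_least bot.extremum_uniqueI bot_ennreal greaterThan_iff)
qed

lemma hausdorff_measure_Un: "hausdorff_measure k (A \<union> B) \<le> hausdorff_measure k A + hausdorff_measure k B"
proof -
  define E where "E = (\<lambda>n::nat. if n = 0 then A else if n = 1 then B else {})"
  have "(\<Union>n. E n) = A \<union> B"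
    unfolding E_def by (auto split: if_splits)
  then have "hausdorff_measure k (A \<union> B) \<le> (\<Sum>n. hausdorff_measure k (E n))"
    using hausdorff_measure_UN[of k E] by simp
  also have "\<dots> = (\<Sum>n\<in>{0,1}. hausdorff_measure k (E n))"
    by (rule suminf_finite) (auto simp: E_def)
  finally show ?thesis by (simp add: E_def)
qed

lemma cover_cost_lipschitz_image:
  fixes f :: "'a::metric_space \<Rightarrow> 'b::metric_space"
  assumes f: "\<And>x y. dist (f x) (f y) \<le> r * dist x y" and "0 < r" and X: "bounded X"
  shows "bounded (f ` X)" "diameter (f ` X) \<le> r * diameter X"
    "cover_cost k (f ` X) \<le> ennreal (r ^ k) * cover_cost k X"
proof -
  show b: "bounded (f ` X)"
  proof (cases "X = {}")
    case False
    then obtain a where "a \<in> X" by auto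
    have "dist (f a) y \<le> r * diameter X" if y: "y \<in> f ` X" for y
    proof -
      obtain x where "x \<in> X" "y = f x" using y by auto
      then show ?thesis using f[of a x] diameter_bounded_bound[OF X \<open>a \<in> X\<close> \<open>x \<in> X\<close>] \<open>0 < r\<close>
        by (meson mult_left_mono less_imp_le order_trans)
    qed
    then show ?thesis by (auto simp: bounded_def)
  qed simp
  show d: "diameter (f ` X) \<le> r * diameter X"
  proof (cases "X = {}")
    case False
    have "dist (f x) (f y) \<le> r * diameter X" if "x \<in> X" "y \<in> X" for x y
      using f[of x y] diameter_bounded_bound[OF X that] \<open>0 < r\<close>
      by (meson mult_left_mono less_imp_le order_trans)
    then show ?thesis
      using False by (auto simp: diameter_def intro!: cSUP_least)
  qed simp
  have "unit_ball_vol (real k) / 2 ^ k * diameter (f ` X) ^ k \<le> r ^ k * (unit_ball_vol (real k) / 2 ^ k * diameter X ^ k)"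
  proof -
    have "diameter (f ` X) ^ k \<le> r ^ k * diameter X ^ k"
      using power_mono[OF d diameter_ge_0[OF b]] by (simp add: power_mult_distrib)
    then have "unit_ball_vol (real k) / 2 ^ k * diameter (f ` X) ^ k \<le> unit_ball_vol (real k) / 2 ^ k * (r ^ k * diameter X ^ k)"
      by (intro mult_left_mono) auto
    then show ?thesis by (simp add: ac_simps)
  qed
  then show "cover_cost k (f ` X) \<le> ennreal (r ^ k) * cover_cost k X"
    using \<open>0 < r\<close> diameter_ge_0[OF X]
    by (auto simp: cover_cost_def ennreal_mult[symmetric])
qed

text \<open>A cover of \<open>E\<close> at scale \<delta> / r is mapped to a cover of the image at
  scale \<delta>, and each cost grows by a factor of at most \<open>r ^ k\<close>. The change of
  scale disappears in the supremum over scales.\<close>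

lemma hausdorff_measure_lipschitz_image:
  fixes f :: "'a::metric_space \<Rightarrow> 'b::metric_space"
  assumes f: "\<And>x y. dist (f x) (f y) \<le> r * dist x y" and r: "0 < r"
  shows "hausdorff_measure k (f ` E) \<le> ennreal (r ^ k) * hausdorff_measure k E"
  unfolding hausdorff_measure_def[of k "f ` E"]
proof (rule SUP_least)
  fix \<delta> :: real assume "\<delta> \<in> {0<..}"
  then have \<delta>: "0 < \<delta> / r" using r by simp
  have "hausdorff_content k \<delta> (f ` E) \<le> ennreal (r ^ k) * (\<Sum>i. cover_cost k (C i))"
    if C: "E \<subseteq> (\<Union>i. C i)" "\<forall>i. bounded (C i) \<and> diameter (C i) \<le> \<delta> / r" for C
  proof -
    have "hausdorff_content k \<delta> (f ` E) \<le> (\<Sum>i. cover_cost k (f ` C i))"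
    proof (rule hausdorff_content_le)
      show "f ` E \<subseteq> (\<Union>i. f ` C i)" using C by blast
      show "bounded (f ` C i)" for i
        using cover_cost_lipschitz_image(1)[OF f r] C by blast
      have "diameter (f ` C i) \<le> r * diameter (C i)" for i
        using cover_cost_lipschitz_image(2)[OF f r] C by blast
      moreover have "r * diameter (C i) \<le> \<delta>" for i
        using C r by (auto simp: field_simps)
      ultimately show "diameter (f ` C i) \<le> \<delta>" for i
        using order_trans by blast
    qed
    also have "\<dots> \<le> (\<Sum>i. ennreal (r ^ k) * cover_cost k (C i))"
      using C by (intro suminf_le cover_cost_lipschitz_image[OF f r]) auto
    finally show ?thesis by simp
  qed
  note le = this
  have inv: "ennreal (inverse r ^ k) * ennreal (r ^ k) = 1" "ennreal (r ^ k) * ennreal (inverse r ^ k) = 1"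
    using r by (simp_all add: ennreal_mult[symmetric] power_mult_distrib[symmetric])
  \<comment> \<open>The factor is first carried to the left, so that the infimum over covers of
    \<open>E\<close> stands alone on the right; it is multiplied back afterwards.\<close>
  have "ennreal (inverse r ^ k) * hausdorff_content k \<delta> (f ` E) \<le> hausdorff_content k (\<delta> / r) E"
    unfolding hausdorff_content_alt[of k "\<delta> / r"]
  proof (rule INF_greatest)
    fix C :: "nat \<Rightarrow> 'a set" assume "C \<in> {C. E \<subseteq> (\<Union>i. C i) \<and> (\<forall>i. bounded (C i) \<and> diameter (C i) \<le> \<delta> / r)}"
    then have "ennreal (inverse r ^ k) * hausdorff_content k \<delta> (f ` E)
        \<le> ennreal (inverse r ^ k) * (ennreal (r ^ k) * (\<Sum>i. cover_cost k (C i)))"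
      by (intro mult_left_mono le) auto
    then show "ennreal (inverse r ^ k) * hausdorff_content k \<delta> (f ` E) \<le> (\<Sum>i. cover_cost k (C i))"
      by (simp only: mult.assoc[symmetric] inv mult_1_left)
  qed
  then have "ennreal (r ^ k) * (ennreal (inverse r ^ k) * hausdorff_content k \<delta> (f ` E))
      \<le> ennreal (r ^ k) * hausdorff_content k (\<delta> / r) E"
    by (intro mult_left_mono) auto
  then have "hausdorff_content k \<delta> (f ` E) \<le> ennreal (r ^ k) * hausdorff_content k (\<delta> / r) E"
    by (simp only: mult.assoc[symmetric] inv mult_1_left)
  also have "\<dots> \<le> ennreal (r ^ k) * hausdorff_measure k E"
    using \<delta> by (intro mult_left_mono hausdorff_content_le_measure) auto
  finally show "hausdorff_content k \<delta> (f ` E) \<le> ennreal (r ^ k) * hausdorff_measure k E" .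
qed

section \<open>Cylinders and flat cubes: Hausdorff measure as volume\<close>

definition cylinder :: "'a::real_vector \<Rightarrow> 'a set \<Rightarrow> 'a set" where
  "cylinder e E = {x + s *\<^sub>R e | x s. x \<in> E \<and> s \<in> {0..1}}"

text \<open>The coordinate of \<open>u\<close> along \<open>e\<close> is ignored: the slices of a
  full cube with corner \<open>u\<close>, at whatever height they are taken, project to one and the
  same flat cube.\<close>

definition flat_cube :: "'a::euclidean_space \<Rightarrow> 'a \<Rightarrow> real \<Rightarrow> 'a set" where
  "flat_cube e u l = {x. x \<bullet> e = 0 \<and> (\<forall>b\<in>Basis - {e}. u \<bullet> b \<le> x \<bullet> b \<and> x \<bullet> b \<le> u \<bullet> b + l)}"

lemma compact_cylinder:
  fixes e :: "'a::real_normed_vector"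
  assumes "compact E"
  shows "compact (cylinder e E)"
proof -
  have "cylinder e E = (\<lambda>(x, s). x + s *\<^sub>R e) ` (E \<times> {0..1})"
    unfolding cylinder_def by fast
  moreover have "continuous_on (E \<times> {0..1}) (\<lambda>(x, s). x + s *\<^sub>R e)"
    by (auto simp: case_prod_unfold intro!: continuous_intros)
  ultimately show ?thesis
    using assms by (simp add: compact_continuous_image compact_Times)
qed

lemma in_cylinder_iff:
  fixes e :: "'a::euclidean_space"
  assumes "norm e = 1" "E \<subseteq> {x. x \<bullet> e = 0}"
  shows "y \<in> cylinder e E \<longleftrightarrow> y \<bullet> e \<in> {0..1} \<and> y - (y \<bullet> e) *\<^sub>R e \<in> E"
proof
  have ee: "e \<bullet> e = 1" using assms(1) by (simp add: norm_eq_1)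
  show "y \<bullet> e \<in> {0..1} \<and> y - (y \<bullet> e) *\<^sub>R e \<in> E" if "y \<in> cylinder e E"
    using that assms ee by (auto simp: cylinder_def inner_left_distrib subset_eq)
  assume "y \<bullet> e \<in> {0..1} \<and> y - (y \<bullet> e) *\<^sub>R e \<in> E"
  then show "y \<in> cylinder e E"
    unfolding cylinder_def by (intro CollectI exI[of _ "y - (y \<bullet> e) *\<^sub>R e"] exI[of _ "y \<bullet> e"]) auto
qed

lemma compact_flat_cube: "compact (flat_cube e u l)"
proof -
  have "flat_cube e u l = {x. x \<bullet> e = 0} \<inter> (\<Inter>b\<in>Basis - {e}. {x. u \<bullet> b \<le> x \<bullet> b} \<inter> {x. x \<bullet> b \<le> u \<bullet> b + l})"
    by (auto simp: flat_cube_def)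
  also have "closed \<dots>"
    by (intro closed_Int closed_INT ballI closed_Collect_eq closed_Collect_le continuous_intros)
  finally have "closed (flat_cube e u l)" .
  moreover have "bounded (flat_cube e u l)"
  proof -
    have "norm x \<le> (\<Sum>b\<in>Basis. \<bar>u \<bullet> b\<bar> + \<bar>l\<bar>)" if x: "x \<in> flat_cube e u l" for x
    proof -
      have "norm x \<le> (\<Sum>b\<in>Basis. \<bar>x \<bullet> b\<bar>)" by (rule norm_le_l1)
      also have "\<dots> \<le> (\<Sum>b\<in>Basis. \<bar>u \<bullet> b\<bar> + \<bar>l\<bar>)"
      proof (rule sum_mono)
        fix b :: 'a assume "b \<in> Basis"
        then show "\<bar>x \<bullet> b\<bar> \<le> \<bar>u \<bullet> b\<bar> + \<bar>l\<bar>"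
          using x by (cases "b = e") (auto simp: flat_cube_def abs_if split: if_splits dest!: bspec[of _ _ b])
      qed
      finally show ?thesis .
    qed
    then show ?thesis by (auto simp: bounded_iff)
  qed
  ultimately show ?thesis by (simp add: compact_eq_bounded_closed)
qed

text \<open>The cube splits into N^(n-1) flat cubes of side 1/N and diameter at most n/N. Their
  total cost does not depend on N, so it bounds the content at every scale.\<close>

lemma hausdorff_measure_flat_cube_finite:
  fixes e :: "'a::euclidean_space"
  assumes e: "e \<in> Basis"
  shows "hausdorff_measure (DIM('a) - 1) (flat_cube e 0 1) < \<infinity>"
proof -
  let ?k = "DIM('a) - 1"
  \<comment> \<open>The factor n^(n-1) comes from the crude diameter bound n/N of the small cubes,
    obtained by summing the coordinates; the powers of N cancel against the number of cubes.\<close>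
  define K where "K = unit_ball_vol (real ?k) / 2 ^ ?k * real DIM('a) ^ ?k"
  have "hausdorff_content ?k \<delta> (flat_cube e 0 1) \<le> ennreal K" if \<delta>: "0 < \<delta>" for \<delta> :: real
  proof -
    obtain N0 :: nat where N0: "real DIM('a) / \<delta> < real N0" using reals_Archimedean2 by blast
    define N where "N = Suc N0"
    have N: "0 < real N" "real DIM('a) / real N \<le> \<delta>"
      using N0 \<delta> by (auto simp: N_def field_simps)
    define I where "I = (Basis - {e}) \<rightarrow>\<^sub>E {..<N}"
    define C where "C = (\<lambda>m. flat_cube e (\<Sum>b\<in>Basis. (real (m b) / real N) *\<^sub>R b) (1 / real N))"
    have inb: "(\<Sum>b\<in>Basis. (real (m b) / real N) *\<^sub>R b) \<bullet> c = real (m c) / real N" if "c \<in> Basis" for m and c :: 'a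
      using that by (simp add: inner_sum_left inner_Basis if_distrib[of "\<lambda>x. _ * x"] cong: if_cong)
    have bdd: "bounded (C m)" for m
      by (simp add: C_def compact_flat_cube compact_imp_bounded)
    have diam: "diameter (C m) \<le> real DIM('a) / real N" for m
    proof (rule diameter_le)
      fix x y assume xy: "x \<in> C m" "y \<in> C m"
      have "norm (x - y) \<le> (\<Sum>b\<in>Basis. \<bar>(x - y) \<bullet> b\<bar>)" by (rule norm_le_l1)
      also have "\<dots> \<le> (\<Sum>b\<in>(Basis::'a set). 1 / real N)"
      proof (rule sum_mono)
        fix b :: 'a assume b: "b \<in> Basis"
        show "\<bar>(x - y) \<bullet> b\<bar> \<le> 1 / real N"
        proof (cases "b = e")
          case False
          then have "real (m b) / real N \<le> x \<bullet> b" "x \<bullet> b \<le> real (m b) / real N + 1 / real N"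
            "real (m b) / real N \<le> y \<bullet> b" "y \<bullet> b \<le> real (m b) / real N + 1 / real N"
            using xy b by (auto simp: C_def flat_cube_def inb)
          then show ?thesis unfolding inner_diff_left by linarith
        qed (use xy in \<open>auto simp: C_def flat_cube_def inner_diff_left\<close>)
      qed
      finally show "norm (x - y) \<le> real DIM('a) / real N" by simp
    qed simp
    have cov: "flat_cube e 0 1 \<subseteq> (\<Union>m\<in>I. C m)"
    proof
      fix x :: 'a assume x: "x \<in> flat_cube e 0 1"
      have "\<exists>j<N. real j / real N \<le> t \<and> t \<le> real j / real N + 1 / real N" if t: "0 \<le> t" "t \<le> 1" for t :: real
      proof (cases "t = 1")
        case True
        \<comment> \<open>At \<open>t = 1\<close> the floor of \<open>t * real N\<close> would give
          the index \<open>N\<close>, one too many; the last interval, of index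
          \<open>N0 = N - 1\<close>, contains this endpoint.\<close>
        then show ?thesis using N by (intro exI[of _ N0]) (auto simp: N_def field_simps)
      next
        case False
        then have "t * real N < real N" using t N by simp
        then have lt: "nat \<lfloor>t * real N\<rfloor> < N" using t
            by (simp add: floor_less_iff nat_less_iff)
        have "real (nat \<lfloor>t * real N\<rfloor>) \<le> t * real N" "t * real N \<le> real (nat \<lfloor>t * real N\<rfloor>) + 1"
          using t by (auto simp: of_nat_floor)
        then show ?thesis using N lt by (intro exI[of _ "nat \<lfloor>t * real N\<rfloor>"]) (auto simp: field_simps)
      qed
      then have "\<forall>b\<in>Basis - {e}. \<exists>j<N. real j / real N \<le> x \<bullet> b \<and> x \<bullet> b \<le> real j / real N + 1 / real N"
        using x by (auto simp: flat_cube_def)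
      then obtain m where m: "\<And>b. b \<in> Basis - {e} \<Longrightarrow> m b < N \<and> real (m b) / real N \<le> x \<bullet> b \<and> x \<bullet> b \<le> real (m b) / real N + 1 / real N"
        by metis
      have "restrict m (Basis - {e}) \<in> I" using m by (auto simp: I_def)
      moreover have "x \<in> C (restrict m (Basis - {e}))"
        using m x unfolding C_def flat_cube_def by (auto simp: inb)
      ultimately show "x \<in> (\<Union>m\<in>I. C m)" by blast
    qed
    have "hausdorff_content ?k \<delta> (flat_cube e 0 1) \<le> (\<Sum>m\<in>I. cover_cost ?k (C m))"
      using cov bdd order_trans[OF diam N(2)] \<delta>
      by (intro hausdorff_content_le_finite) (auto simp: I_def intro!: finite_PiE)
    also have "\<dots> \<le> (\<Sum>m\<in>I. ennreal (unit_ball_vol (real ?k) / 2 ^ ?k * (real DIM('a) / real N) ^ ?k))"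
    proof (rule sum_mono)
      fix m
      have "diameter (C m) ^ ?k \<le> (real DIM('a) / real N) ^ ?k"
        using diam diameter_ge_0[OF bdd] by (intro power_mono) auto
      then show "cover_cost ?k (C m) \<le> ennreal (unit_ball_vol (real ?k) / 2 ^ ?k * (real DIM('a) / real N) ^ ?k)"
        by (auto simp: cover_cost_def intro!: ennreal_leI mult_left_mono divide_right_mono)
    qed
    also have "\<dots> = of_nat (card I) * ennreal (unit_ball_vol (real ?k) / 2 ^ ?k * (real DIM('a) / real N) ^ ?k)"
      by simp
    also have "card I = N ^ ?k"
      using e by (simp add: I_def card_PiE card_Diff_singleton)
    also have "of_nat (N ^ ?k) * ennreal (unit_ball_vol (real ?k) / 2 ^ ?k * (real DIM('a) / real N) ^ ?k) = ennreal K"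
      using N by (simp add: K_def ennreal_of_nat_eq_real_of_nat ennreal_mult[symmetric] power_divide)
    finally show ?thesis .
  qed
  then have "hausdorff_measure ?k (flat_cube e 0 1) \<le> ennreal K"
    unfolding hausdorff_measure_def by (intro SUP_least) auto
  then show ?thesis
    by (simp add: le_less_trans)
qed

text \<open>The two cubes are exchanged by a homothety of ratio \<open>l\<close> and its inverse;
  the Lipschitz estimate for both maps gives the two inequalities. The translation \<open>p\<close>
  is \<open>u\<close> without its \<open>e\<close>-component, since flat cubes lie in the hyperplane
  through 0.\<close>

lemma hausdorff_measure_flat_cube:
  fixes e :: "'a::euclidean_space"
  assumes e: "e \<in> Basis" and l: "0 < l"
  shows "hausdorff_measure k (flat_cube e u l) = ennreal (l ^ k) * hausdorff_measure k (flat_cube e 0 1)"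
proof -
  define p where "p = u - (u \<bullet> e) *\<^sub>R e"
  define f where "f = (\<lambda>x. l *\<^sub>R x + p)"
  define g where "g = (\<lambda>x. inverse l *\<^sub>R (x - p))"
  have p: "p \<bullet> e = 0" "\<And>b. b \<in> Basis - {e} \<Longrightarrow> p \<bullet> b = u \<bullet> b"
    using e by (auto simp: p_def inner_diff_left inner_Basis)
  have fg: "f (g x) = x" for x using l by (simp add: f_def g_def)
  have f: "f ` flat_cube e 0 1 \<subseteq> flat_cube e u l"
    using p l by (auto simp: f_def flat_cube_def inner_left_distrib algebra_simps mult_left_le)
  have g: "g ` flat_cube e u l \<subseteq> flat_cube e 0 1"
    using p l by (auto simp: g_def flat_cube_def inner_diff_left field_simps)
  have "flat_cube e u l = f ` flat_cube e 0 1"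
  proof (rule antisym[OF _ f])
    show "flat_cube e u l \<subseteq> f ` flat_cube e 0 1"
      using g fg by (metis image_eqI image_subset_iff subsetI)
  qed
  moreover have "dist (f x) (f y) \<le> l * dist x y" for x y
    using l by (simp add: f_def dist_norm flip: scaleR_diff_right)
  ultimately have le: "hausdorff_measure k (flat_cube e u l) \<le> ennreal (l ^ k) * hausdorff_measure k (flat_cube e 0 1)"
    using hausdorff_measure_lipschitz_image l by metis
  have "flat_cube e 0 1 = g ` flat_cube e u l"
  proof (rule antisym[OF _ g])
    have "g (f x) = x" for x using l by (simp add: f_def g_def)
    then show "flat_cube e 0 1 \<subseteq> g ` flat_cube e u l"
      using f by (metis image_eqI image_subset_iff subsetI)
  qed
  moreover have "dist (g x) (g y) \<le> inverse l * dist x y" for x y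
    using l by (simp add: g_def dist_norm flip: scaleR_diff_right)
  ultimately have "hausdorff_measure k (flat_cube e 0 1) \<le> ennreal (inverse l ^ k) * hausdorff_measure k (flat_cube e u l)"
    using hausdorff_measure_lipschitz_image l by (metis positive_imp_inverse_positive)
  then have "ennreal (l ^ k) * hausdorff_measure k (flat_cube e 0 1)
      \<le> ennreal (l ^ k) * (ennreal (inverse l ^ k) * hausdorff_measure k (flat_cube e u l))"
    by (intro mult_left_mono) auto
  also have "\<dots> = hausdorff_measure k (flat_cube e u l)"
    using l by (simp add: mult.assoc[symmetric] ennreal_mult[symmetric] power_mult_distrib[symmetric])
  finally show ?thesis using le by (rule antisym[rotated])
qed

text \<open>
  A cover of the cylinder by cubes yields, at each height \<open>s \<in> [0, 1]\<close>, a cover of \<open>E\<close> by flat cubes;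
  the average over \<open>s\<close> of the sizes of these covers is the total volume of the cubes.
\<close>

lemma hausdorff_measure_le_cylinder:
  fixes e :: "'a::euclidean_space"
  assumes e: "e \<in> Basis" and E: "E \<subseteq> {x. x \<bullet> e = 0}" "bounded E"
    and S[measurable]: "cylinder e E \<in> sets borel"
  shows "hausdorff_measure (DIM('a) - 1) E
    \<le> hausdorff_measure (DIM('a) - 1) (flat_cube e 0 1) * emeasure lborel (cylinder e E)"
proof -
  let ?H = "hausdorff_measure (DIM('a) - 1) :: 'a set \<Rightarrow> ennreal"
  let ?S = "cylinder e E"
  define c where "c = ?H (flat_cube e 0 1)"
  have c: "c < \<infinity>" unfolding c_def by (rule hausdorff_measure_flat_cube_finite[OF e])
  have ne: "norm e = 1" using e by simp
  have bounded_S: "bounded ?S"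
  proof -
    obtain B where "\<And>x. x \<in> E \<Longrightarrow> norm x \<le> B" using E(2) by (auto simp: bounded_iff)
    then have "norm y \<le> B + 1" if "y \<in> ?S" for y
      using that ne by (auto simp: cylinder_def intro!: norm_triangle_le add_mono)
    then show ?thesis by (auto simp: bounded_iff)
  qed
  then obtain a where a: "?S \<subseteq> cbox (- a) a"
    using bounded_subset_cbox_symmetric by blast
  \<comment> \<open>The enclosing box is taken to be a cube of side \<open>L\<close>: the pieces
    supplied by \<open>covering_lemma\<close> have sides (q - p) / 2^n, hence are cubes as well. The
    summand 1 keeps \<open>L\<close> positive.\<close>
  define L where "L = 2 * (\<Sum>b\<in>Basis. \<bar>a \<bullet> b\<bar>) + 1"
  define p where "p = (- (L / 2)) *\<^sub>R (\<Sum>b\<in>Basis. b :: 'a)"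
  define q where "q = (L / 2) *\<^sub>R (\<Sum>b\<in>Basis. b :: 'a)"
  have L: "0 < L" by (auto simp: L_def intro!: add_nonneg_pos sum_nonneg)
  have pq: "p \<bullet> b = - (L / 2)" "q \<bullet> b = L / 2" if "b \<in> Basis" for b
    using that by (simp_all add: p_def q_def inner_sum_left inner_Basis)
  have ab: "\<bar>a \<bullet> b\<bar> \<le> L / 2" if "b \<in> Basis" for b
    using member_le_sum[OF that, of "\<lambda>b. \<bar>a \<bullet> b\<bar>"] by (simp add: L_def)
  have S_sub: "?S \<subseteq> cbox p q"
  proof -
    have "cbox (- a) a \<subseteq> cbox p q"
    proof (intro subset_box_imp ballI)
      fix b :: 'a assume "b \<in> Basis"
      with ab[OF this] show "p \<bullet> b \<le> (- a) \<bullet> b \<and> a \<bullet> b \<le> q \<bullet> b"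
        by (simp only: pq[OF \<open>b \<in> Basis\<close>] abs_le_iff inner_minus_left) auto
    qed
    with a show ?thesis by blast
  qed
  have box_ne: "box p q \<noteq> {}" using L by (simp add: box_ne_empty pq)
  have main: "?H E \<le> c * (emeasure lborel ?S + ennreal \<epsilon>)" if \<epsilon>: "0 < \<epsilon>" for \<epsilon> :: real
  proof -
    obtain T where T: "open T" "?S \<subseteq> T" "emeasure lborel (T - ?S) < ennreal \<epsilon>"
      using outer_regular_lborel[OF S \<epsilon>] by blast
    have [measurable]: "T \<in> sets borel" using T by simp
    \<comment> \<open>Each piece is contained in \<open>g x\<close> for some \<open>x\<close> of the
      cylinder, and there \<open>g x = T\<close>. This gauge thus confines all pieces to
      \<open>T\<close>, whose volume exceeds that of the cylinder by less than \<epsilon>.\<close>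
    define g where "g = (\<lambda>x. if x \<in> T then T else UNIV)"
    have "gauge g" using T by (auto simp: g_def gauge_def)
    obtain D where D:
      "countable D" "\<Union>D \<subseteq> cbox p q" "\<And>K. K \<in> D \<Longrightarrow> interior K \<noteq> {} \<and> (\<exists>c d. K = cbox c d)"
      "pairwise (\<lambda>A B. interior A \<inter> interior B = {}) D"
      "\<And>K. K \<in> D \<Longrightarrow> \<exists>x \<in> ?S \<inter> K. K \<subseteq> g x"
      "\<And>u v. cbox u v \<in> D \<Longrightarrow> \<exists>n. \<forall>i \<in> Basis. v \<bullet> i - u \<bullet> i = (q \<bullet> i - p \<bullet> i) / 2^n"
      "?S \<subseteq> \<Union>D"
      by (rule covering_lemma[OF S_sub box_ne \<open>gauge g\<close>]) (rule that; assumption)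
    have "\<exists>u l. K = cbox u (u + l *\<^sub>R (\<Sum>b\<in>Basis. b)) \<and> 0 < l" if K: "K \<in> D" for K
    proof -
      obtain u w where uw: "K = cbox u w" using D(3) K by blast
      obtain n where n: "\<forall>i \<in> Basis. w \<bullet> i - u \<bullet> i = (q \<bullet> i - p \<bullet> i) / 2^n"
        using D(6) K uw by blast
      have "w = u + (L / 2 ^ n) *\<^sub>R (\<Sum>b\<in>Basis. b)"
      proof (rule euclidean_eqI)
        fix b :: 'a assume b: "b \<in> Basis"
        with n have "w \<bullet> b - u \<bullet> b = L / 2 ^ n" by (simp add: pq)
        then have "w \<bullet> b = u \<bullet> b + L / 2 ^ n" by linarith
        then show "w \<bullet> b = (u + (L / 2 ^ n) *\<^sub>R (\<Sum>b\<in>Basis. b)) \<bullet> b"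
          using b by (simp add: inner_left_distrib inner_sum_left inner_Basis)
      qed
      with uw L show ?thesis by (intro exI[of _ u] exI[of _ "L / 2 ^ n"]) auto
    qed
    then obtain u l where ul: "\<And>K. K \<in> D \<Longrightarrow> K = cbox (u K) (u K + l K *\<^sub>R (\<Sum>b\<in>Basis. b))" "\<And>K. K \<in> D \<Longrightarrow> 0 < l K"
      by metis
    define top where "top K = u K + l K *\<^sub>R (\<Sum>b\<in>Basis. b)" for K
    have top: "top K \<bullet> b = u K \<bullet> b + l K" if "b \<in> Basis" for K b
      using that by (simp add: top_def inner_left_distrib inner_sum_left inner_Basis)
    define J where "J = to_nat_on D ` D"
    define F where "F = from_nat_into D"
    have FJ: "F i \<in> D" if "i \<in> J" for i
      using that D(1) by (auto simp: J_def F_def)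
    have F_inj: "F i \<noteq> F j" if "i \<in> J" "j \<in> J" "i \<noteq> j" for i j
      using that D(1) by (auto simp: J_def F_def)
    have F_surj: "\<exists>i\<in>J. F i = K" if "K \<in> D" for K
      using that D(1) by (auto simp: J_def F_def)
    \<comment> \<open>For the cube \<open>F i\<close>, \<open>h i\<close> is the Hausdorff measure
      of each of its slices, \<open>I i\<close> is the interval of heights at which it is met, and
      \<open>U i\<close> is its interior.\<close>
    define h where "h i = (if i \<in> J then ennreal (l (F i) ^ (DIM('a) - 1)) * c else 0)" for i
    define I where "I i = {u (F i) \<bullet> e .. u (F i) \<bullet> e + l (F i)}" for i
    define U where "U i = (if i \<in> J then box (u (F i)) (top (F i)) else {})" for i
    have [measurable]: "I i \<in> sets borel" for i by (simp add: I_def)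
    have slice: "?H E \<le> (\<Sum>i. h i * indicator (I i) s)" if s: "s \<in> {0..1}" for s
    proof -
      define G where "G i = (if i \<in> J \<and> s \<in> I i then flat_cube e (u (F i)) (l (F i)) else {})" for i
      have "E \<subseteq> (\<Union>i. G i)"
      proof
        fix x assume x: "x \<in> E"
        then have "x + s *\<^sub>R e \<in> ?S" using s by (auto simp: cylinder_def)
        then obtain i where i: "i \<in> J" "x + s *\<^sub>R e \<in> F i" using D(7) F_surj by fast
        then have "x + s *\<^sub>R e \<in> cbox (u (F i)) (top (F i))" using ul FJ by (metis top_def)
        then have xs: "u (F i) \<bullet> b \<le> (x + s *\<^sub>R e) \<bullet> b \<and> (x + s *\<^sub>R e) \<bullet> b \<le> u (F i) \<bullet> b + l (F i)" if "b \<in> Basis" for b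
          using that by (auto simp: mem_box top)
        have "s \<in> I i" using xs[OF e] e E x by (auto simp: I_def inner_left_distrib)
        moreover have "x \<in> flat_cube e (u (F i)) (l (F i))"
        proof -
          have "u (F i) \<bullet> b \<le> x \<bullet> b \<and> x \<bullet> b \<le> u (F i) \<bullet> b + l (F i)" if "b \<in> Basis - {e}" for b
            using xs[of b] that e by (auto simp: inner_left_distrib inner_Basis)
          then show ?thesis using E x by (auto simp: flat_cube_def)
        qed
        ultimately show "x \<in> (\<Union>i. G i)" using i by (auto simp: G_def intro!: exI[of _ i])
      qed
      then have "?H E \<le> ?H (\<Union>i. G i)" by (rule hausdorff_measure_mono)
      also have "\<dots> \<le> (\<Sum>i. ?H (G i))" by (rule hausdorff_measure_UN)
      also have "(\<lambda>i. ?H (G i)) = (\<lambda>i. h i * indicator (I i) s)"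
        using hausdorff_measure_flat_cube[OF e ul(2)[OF FJ]]
        by (auto simp: G_def h_def c_def fun_eq_iff indicator_def)
      finally show ?thesis .
    qed
    \<comment> \<open>The left side does not depend on the height, and the interval of heights has
      length 1, so integrating the slice estimate over it loses nothing.\<close>
    have "?H E = (\<integral>\<^sup>+s. ?H E * indicator {0..1::real} s \<partial>lborel)"
      by (simp add: nn_integral_cmult_indicator)
    also have "\<dots> \<le> (\<integral>\<^sup>+s. (\<Sum>i. h i * indicator (I i) s) \<partial>lborel)"
      using slice by (intro nn_integral_mono) (auto simp: indicator_def)
    also have "\<dots> = (\<Sum>i. \<integral>\<^sup>+s. h i * indicator (I i) s \<partial>lborel)"
      by (rule nn_integral_suminf) simp
    also have "\<dots> = (\<Sum>i. c * emeasure lborel (U i))"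
    proof (rule suminf_cong)
      fix i
      \<comment> \<open>Slice measure c l^(n-1), integrated over l units of height, gives c times
        the volume l^n of the cube.\<close>
      have "ennreal (l (F i) ^ (DIM('a) - 1)) * c * ennreal (l (F i)) = c * ennreal (l (F i) ^ DIM('a))" if "i \<in> J"
      proof -
        have "l (F i) ^ DIM('a) = l (F i) ^ (DIM('a) - 1) * l (F i)"
          using power_Suc2[of "l (F i)" "DIM('a) - 1"] by simp
        with ul(2)[OF FJ[OF that]] show ?thesis by (simp add: ennreal_mult ac_simps)
      qed
      then show "(\<integral>\<^sup>+s. h i * indicator (I i) s \<partial>lborel) = c * emeasure lborel (U i)"
        using ul(2)[OF FJ, of i]
        by (auto simp: nn_integral_cmult_indicator h_def U_def I_def emeasure_lborel_box_eq top inner_diff_left)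
    qed
    also have "\<dots> = c * (\<Sum>i. emeasure lborel (U i))" by simp
    also have "(\<Sum>i. emeasure lborel (U i)) = emeasure lborel (\<Union>i. U i)"
    proof (rule suminf_emeasure)
      show "disjoint_family U"
      proof -
        have "U i \<inter> U j = {}" if "i \<noteq> j" for i j
        proof (cases "i \<in> J \<and> j \<in> J")
          case True
          then have "interior (F i) \<inter> interior (F j) = {}"
            using D(4) FJ F_inj that by (auto simp: pairwise_def)
          moreover have "interior (F i) = box (u (F i)) (top (F i))" if "i \<in> J" for i
            using ul(1)[OF FJ[OF that]] interior_cbox by (metis top_def)
          ultimately show ?thesis using True by (simp add: U_def)
        qed (auto simp: U_def)
        then show ?thesis by (auto simp: disjoint_family_on_def)
      qed
    qed (auto simp: U_def)
    also have "\<dots> \<le> emeasure lborel T"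
    proof (rule emeasure_mono)
      have "U i \<subseteq> T" for i
      proof (cases "i \<in> J")
        case True
        then have "U i \<subseteq> F i" using ul(1)[OF FJ[OF True]] box_subset_cbox by (metis U_def top_def)
        also have "F i \<subseteq> T" using D(5)[OF FJ[OF True]] T by (auto simp: g_def split: if_splits)
        finally show ?thesis .
      qed (simp add: U_def)
      then show "(\<Union>i. U i) \<subseteq> T" by blast
    qed simp
    also have "emeasure lborel T = emeasure lborel (?S \<union> (T - ?S))"
      using T(2) by (simp add: Un_absorb1)
    also have "\<dots> \<le> emeasure lborel ?S + emeasure lborel (T - ?S)"
      by (rule emeasure_subadditive) auto
    also have "\<dots> \<le> emeasure lborel ?S + ennreal \<epsilon>"
      using T(3) by (intro add_mono) auto
    finally show ?thesis by (simp add: mult_left_mono)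
  qed
  have "?H E \<le> c * emeasure lborel ?S"
  proof (rule ennreal_le_epsilon)
    fix \<epsilon> :: real assume \<epsilon>: "0 < \<epsilon>"
    obtain r where r: "0 \<le> r" "c = ennreal r" using c by (cases c) auto
    \<comment> \<open>The error is divided by \<open>r + 1\<close> because \<open>r\<close> is only
      known to be nonnegative.\<close>
    have "?H E \<le> c * (emeasure lborel ?S + ennreal (\<epsilon> / (r + 1)))"
      using \<epsilon> r by (intro main) auto
    also have "\<dots> = c * emeasure lborel ?S + ennreal (r * (\<epsilon> / (r + 1)))"
    proof -
      have "ennreal r * ennreal (\<epsilon> / (r + 1)) = ennreal (r * (\<epsilon> / (r + 1)))"
        using \<epsilon> r by (intro ennreal_mult[symmetric]) auto
      then show ?thesis by (simp only: r distrib_left)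
    qed
    also have "\<dots> \<le> c * emeasure lborel ?S + ennreal \<epsilon>"
      using \<epsilon> r by (intro add_left_mono ennreal_leI) (simp add: field_simps)
    finally show "?H E \<le> c * emeasure lborel ?S + ennreal \<epsilon>" .
  qed
  then show ?thesis by (simp add: c_def)
qed

text \<open>The upper bound becomes a lower bound by complementation inside a flat cube, whose
  measure is known exactly from scaling. Compactness of \<open>E\<close> makes its cylinder Borel;
  the complement need not be compact, which is why the upper bound is stated for bounded sets with
  Borel cylinder.\<close>

lemma hausdorff_measure_eq_cylinder:
  fixes e :: "'a::euclidean_space"
  assumes e: "e \<in> Basis" and E: "E \<subseteq> {x. x \<bullet> e = 0}" "compact E"
  shows "hausdorff_measure (DIM('a) - 1) E
    = hausdorff_measure (DIM('a) - 1) (flat_cube e 0 1) * emeasure lborel (cylinder e E)"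
proof (rule antisym)
  let ?H = "hausdorff_measure (DIM('a) - 1) :: 'a set \<Rightarrow> ennreal"
  define c where "c = ?H (flat_cube e 0 1)"
  have c: "c < \<infinity>" unfolding c_def by (rule hausdorff_measure_flat_cube_finite[OF e])
  have ne: "norm e = 1" using e by simp
  have cyl_E [measurable]: "cylinder e E \<in> sets borel"
    using E by (simp add: compact_cylinder borel_compact)
  show "?H E \<le> ?H (flat_cube e 0 1) * emeasure lborel (cylinder e E)"
    using E by (intro hausdorff_measure_le_cylinder e) (auto simp: compact_imp_bounded)
  obtain a where a: "E \<subseteq> cbox (- a) a"
    using bounded_subset_cbox_symmetric[OF compact_imp_bounded[OF E(2)]] by blast
  define L where "L = (\<Sum>b\<in>Basis. \<bar>a \<bullet> b\<bar>) + 1"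
  have L: "0 < L" by (auto simp: L_def intro!: add_nonneg_pos sum_nonneg)
  have ab: "\<bar>a \<bullet> b\<bar> \<le> L" if "b \<in> Basis" for b
    using member_le_sum[OF that, of "\<lambda>b. \<bar>a \<bullet> b\<bar>"] by (simp add: L_def)
  define p where "p = (- L) *\<^sub>R (\<Sum>b\<in>Basis. b :: 'a)"
  have p: "p \<bullet> b = - L" if "b \<in> Basis" for b
    using that by (simp add: p_def inner_sum_left inner_Basis)
  define Q where "Q = flat_cube e p (2 * L)"
  have EQ: "E \<subseteq> Q"
  proof
    fix x assume x: "x \<in> E"
    have "- L \<le> x \<bullet> b \<and> x \<bullet> b \<le> L" if "b \<in> Basis" for b
      using a x ab[OF that] that by (fastforce simp: mem_box)
    then show "x \<in> Q" using x E by (auto simp: Q_def flat_cube_def p)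
  qed
  have Q_sub: "Q \<subseteq> {x. x \<bullet> e = 0}" by (auto simp: Q_def flat_cube_def)
  have QE: "Q - E \<subseteq> {x. x \<bullet> e = 0}" using Q_sub by auto
  have cyl_Q [measurable]: "cylinder e Q \<in> sets borel"
    by (simp add: Q_def compact_flat_cube compact_cylinder borel_compact)
  have cyl_diff: "cylinder e (Q - E) = cylinder e Q - cylinder e E"
    using in_cylinder_iff[OF ne Q_sub] in_cylinder_iff[OF ne E(1)] in_cylinder_iff[OF ne QE] by blast
  have sub: "cylinder e E \<subseteq> cylinder e Q"
    using in_cylinder_iff[OF ne Q_sub] in_cylinder_iff[OF ne E(1)] EQ by blast
  have fin: "emeasure lborel (cylinder e E) < \<infinity>"
    using E by (intro emeasure_compact_finite compact_cylinder)
  have finQ: "emeasure lborel (cylinder e Q) < \<infinity>"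
    unfolding Q_def by (intro emeasure_compact_finite compact_cylinder compact_flat_cube)
  \<comment> \<open>\<open>p\<close> has coordinate - L along \<open>e\<close> too. The multiples of
    \<open>e\<close> correct this: - L + L = 0 at the lower corner and - L + 2 L + (1 - L) = 1 at
    the upper one.\<close>
  have cyl_Q_eq: "cylinder e Q = cbox (p + L *\<^sub>R e) (p + (2 * L) *\<^sub>R (\<Sum>b\<in>Basis. b) + (1 - L) *\<^sub>R e)"
  proof -
    have "y \<in> cylinder e Q \<longleftrightarrow> y \<in> cbox (p + L *\<^sub>R e) (p + (2 * L) *\<^sub>R (\<Sum>b\<in>Basis. b) + (1 - L) *\<^sub>R e)" for y
    proof -
      have *: "(p + (2 * L) *\<^sub>R (\<Sum>b\<in>Basis. b) + (1 - L) *\<^sub>R e) \<bullet> b = (if b = e then 1 else L)"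
        "(p + L *\<^sub>R e) \<bullet> b = (if b = e then 0 else - L)" if "b \<in> Basis" for b
        using that e by (auto simp: p inner_left_distrib inner_sum_left inner_Basis)
      have "y - (y \<bullet> e) *\<^sub>R e \<in> Q \<longleftrightarrow> (\<forall>b\<in>Basis - {e}. - L \<le> y \<bullet> b \<and> y \<bullet> b \<le> L)"
        using e by (auto simp: Q_def flat_cube_def p inner_diff_left inner_Basis)
      then show ?thesis
        unfolding in_cylinder_iff[OF ne Q_sub] using e by (auto simp: mem_box *)
    qed
    then show ?thesis by blast
  qed
  have "emeasure lborel (cylinder e Q) = ennreal ((2 * L) ^ (DIM('a) - 1))"
  proof -
    have *: "((p + (2 * L) *\<^sub>R (\<Sum>b\<in>Basis. b) + (1 - L) *\<^sub>R e) - (p + L *\<^sub>R e)) \<bullet> b = (if b = e then 1 else 2 * L)"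
      if "b \<in> Basis" for b
      using that e by (auto simp: p inner_left_distrib inner_diff_left inner_sum_left inner_Basis)
    have **: "(p + L *\<^sub>R e) \<bullet> b \<le> (p + (2 * L) *\<^sub>R (\<Sum>b\<in>Basis. b) + (1 - L) *\<^sub>R e) \<bullet> b" if "b \<in> Basis" for b
    proof -
      have "0 \<le> ((p + (2 * L) *\<^sub>R (\<Sum>b\<in>Basis. b) + (1 - L) *\<^sub>R e) - (p + L *\<^sub>R e)) \<bullet> b"
        unfolding *[OF that] using L by simp
      then show ?thesis unfolding inner_diff_left by (simp only: diff_ge_0_iff_ge)
    qed
    have "emeasure lborel (cylinder e Q) = ennreal (\<Prod>b\<in>Basis. (if b = e then 1 else 2 * L))"
      unfolding cyl_Q_eq emeasure_lborel_cbox_eq using ** * by (simp cong: prod.cong)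
    also have "(\<Prod>b\<in>Basis. (if b = e then 1 else 2 * L)) = (\<Prod>b\<in>Basis - {e}. 2 * L)"
      using e by (subst prod.remove[of _ e]) (auto intro!: prod.cong)
    finally show ?thesis using e by (simp add: card_Diff_singleton)
  qed
  then have HQ: "?H Q = c * emeasure lborel (cylinder e Q)"
    unfolding Q_def c_def using hausdorff_measure_flat_cube[OF e, of "2 * L" _ p] L by (simp add: mult.commute)
  have bQE: "bounded (Q - E)"
    unfolding Q_def by (meson Diff_subset bounded_subset compact_flat_cube compact_imp_bounded)
  have HQE: "?H (Q - E) \<le> c * emeasure lborel (cylinder e Q - cylinder e E)"
    using hausdorff_measure_le_cylinder[OF e QE bQE] unfolding cyl_diff c_def by simp
  \<comment> \<open>Equality holds for the flat cube \<open>Q\<close>, and the upper bound for \<open>Q - E\<close> forces the lower one for \<open>E\<close>.\<close>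
  have "c * emeasure lborel (cylinder e E) + c * emeasure lborel (cylinder e Q - cylinder e E)
      = c * emeasure lborel (cylinder e Q)"
    using sub by (simp add: distrib_left[symmetric] plus_emeasure Un_absorb1)
  also have "\<dots> = ?H Q" by (rule HQ[symmetric])
  also have "\<dots> \<le> ?H (E \<union> (Q - E))" by (rule hausdorff_measure_mono) auto
  also have "\<dots> \<le> ?H E + ?H (Q - E)" by (rule hausdorff_measure_Un)
  also have "\<dots> \<le> ?H E + c * emeasure lborel (cylinder e Q - cylinder e E)"
    by (intro add_left_mono HQE)
  finally have le: "c * emeasure lborel (cylinder e E) + c * emeasure lborel (cylinder e Q - cylinder e E)
      \<le> ?H E + c * emeasure lborel (cylinder e Q - cylinder e E)" .
  have "emeasure lborel (cylinder e Q - cylinder e E) \<le> emeasure lborel (cylinder e Q)"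
    by (rule emeasure_mono) auto
  \<comment> \<open>Finiteness is what permits cancelling the complement in
    \<open>ennreal\<close>.\<close>
  then have "c * emeasure lborel (cylinder e Q - cylinder e E) < \<infinity>"
    using c finQ by (auto simp: ennreal_mult_less_top le_less_trans)
  with le have "c * emeasure lborel (cylinder e E) \<le> ?H E"
    by (metis add.commute ennreal_add_left_cancel_le infinity_ennreal_def less_irrefl)
  then show "?H (flat_cube e 0 1) * emeasure lborel (cylinder e E) \<le> ?H E"
    by (simp add: c_def)
qed

subsection \<open>The Brunn-Minkowski inequality\<close>

text \<open>Prepares the one-dimensional Brunn-Minkowski inequality, whose argument wants a set with
  a largest element. If \<open>A\<close> has none, a sequence in \<open>A\<close> is cofinal in it,
  and continuity of the measure from below applies.\<close>

lemma emeasure_le_SUP_atMost: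
  fixes A :: "real set"
  assumes [measurable]: "A \<in> sets borel" and ne: "A \<noteq> {}" and M: "sets M = sets borel"
  shows "emeasure M A \<le> (SUP a\<in>A. emeasure M (A \<inter> {..a}))"
proof (cases "\<exists>m\<in>A. \<forall>x\<in>A. x \<le> m")
  case True
  then obtain m where m: "m \<in> A" "A \<inter> {..m} = A" by blast
  then show ?thesis by (metis SUP_upper)
next
  case False
  obtain a0 where a0: "a0 \<in> A" using ne by blast
  \<comment> \<open>A point of \<open>A\<close> is chosen beyond each rational that has one, so that
    countably many points suffice; \<open>a0\<close> is an arbitrary value for the other
    rationals.\<close>
  define b where "b n = (if \<exists>y\<in>A. from_nat_into \<rat> n < y then SOME y. y \<in> A \<and> from_nat_into \<rat> n < y else a0)" for n
  have b: "b n \<in> A" "\<exists>y\<in>A. from_nat_into \<rat> n < y \<Longrightarrow> from_nat_into \<rat> n < b n" for n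
    using a0 unfolding b_def by (auto intro: someI2_ex)
  have cofinal: "\<exists>n. x \<le> b n" if x: "x \<in> A" for x
  proof -
    obtain y where y: "y \<in> A" "x < y" using False x by (meson not_le)
    obtain q where q: "q \<in> \<rat>" "x < q" "q < y" using Rats_dense_in_real[OF y(2)] by blast
    obtain n where n: "from_nat_into \<rat> n = q"
      using from_nat_into_surj[OF countable_rat q(1)] by blast
    have "q < b n" using b(2)[of n] y q n by blast
    then show ?thesis using q by (intro exI[of _ n]) auto
  qed
  \<comment> \<open>The sequence \<open>b\<close> need not be monotone; finite unions make the
    truncations increasing, and each of them is a cut at the maximum of finitely many
    \<open>b k\<close>.\<close>
  define B where "B n = (\<Union>k\<le>n. A \<inter> {..b k})" for n
  have "(\<Union>n. B n) = A" using cofinal by (force simp: B_def)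
  moreover have "incseq B" by (auto simp: B_def incseq_def) (meson atMost_iff order_trans)
  moreover have "range B \<subseteq> sets M" by (auto simp: B_def M)
  ultimately have "emeasure M A = (SUP n. emeasure M (B n))"
    using SUP_emeasure_incseq[of B M] by simp
  also have "\<dots> \<le> (SUP a\<in>A. emeasure M (A \<inter> {..a}))"
  proof (rule SUP_least)
    fix n
    have "Max (b ` {..n}) \<in> b ` {..n}" by (intro Max_in) auto
    moreover have "b ` {..n} \<subseteq> A" using b(1) by blast
    ultimately have mA: "Max (b ` {..n}) \<in> A" by (rule subsetD[rotated])
    have "B n \<subseteq> A \<inter> {..Max (b ` {..n})}"
      by (auto simp: B_def intro: order_trans[OF _ Max_ge])
    then have "emeasure M (B n) \<le> emeasure M (A \<inter> {..Max (b ` {..n})})"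
      by (rule emeasure_mono) (simp add: M)
    also have "\<dots> \<le> (SUP a\<in>A. emeasure M (A \<inter> {..a}))" using mA by (rule SUP_upper)
    finally show "emeasure M (B n) \<le> (SUP a\<in>A. emeasure M (A \<inter> {..a}))" .
  qed
  finally show ?thesis .
qed

lemma emeasure_lborel_uminus_vimage:
  fixes X :: "real set"
  assumes "X \<in> sets borel"
  shows "emeasure lborel (uminus -` X) = emeasure lborel X"
proof -
  have "emeasure lborel X = emeasure (distr lborel borel uminus) X" by (simp add: lborel_distr_uminus)
  also have "\<dots> = emeasure lborel (uminus -` X)" using assms by (subst emeasure_distr) auto
  finally show ?thesis by simp
qed

lemma emeasure_le_SUP_atLeast:
  fixes A :: "real set"
  assumes A[measurable]: "A \<in> sets borel" and ne: "A \<noteq> {}"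
  shows "emeasure lborel A \<le> (SUP a\<in>A. emeasure lborel (A \<inter> {a..}))"
proof -
  define A' where "A' = uminus -` A"
  have [measurable]: "A' \<in> sets borel"
    using measurable_sets[of uminus borel borel A] by (simp add: A'_def)
  have ne': "A' \<noteq> {}" unfolding A'_def using ne by (metis all_not_in_conv minus_minus vimageI)
  have "emeasure lborel A = emeasure lborel A'"
    by (simp add: A'_def emeasure_lborel_uminus_vimage)
  also have "\<dots> \<le> (SUP a\<in>A'. emeasure lborel (A' \<inter> {..a}))"
    by (rule emeasure_le_SUP_atMost) (use ne' in auto)
  also have "\<dots> \<le> (SUP a\<in>A. emeasure lborel (A \<inter> {a..}))"
  proof (rule SUP_mono)
    fix a assume a: "a \<in> A'"
    have "A' \<inter> {..a} = uminus -` (A \<inter> {- a..})" by (auto simp: A'_def)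
    then have "emeasure lborel (A' \<inter> {..a}) = emeasure lborel (A \<inter> {- a..})"
      using emeasure_lborel_uminus_vimage[of "A \<inter> {- a..}"] by simp
    then show "\<exists>m\<in>A. emeasure lborel (A' \<inter> {..a}) \<le> emeasure lborel (A \<inter> {m..})"
      using a by (intro bexI[of _ "- a"]) (auto simp: A'_def)
  qed
  finally show ?thesis .
qed

text \<open>The set on the right is (X + c) / 2, the set of midpoints of \<open>c\<close> with the
  points of \<open>X\<close>; this contraction halves lengths.\<close>

lemma emeasure_lborel_double_vimage:
  fixes X :: "real set"
  assumes [measurable]: "X \<in> sets borel"
  shows "emeasure lborel X = 2 * emeasure lborel {t. - c + 2 * t \<in> X}"
proof -
  have "emeasure lborel X = (\<integral>\<^sup>+x. indicator X x \<partial>lborel)" by simp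
  also have "\<dots> = 2 * (\<integral>\<^sup>+x. indicator X (- c + 2 * x) \<partial>lborel)"
    by (subst nn_integral_real_affine[of _ 2 "- c"]) auto
  also have "(\<integral>\<^sup>+x. indicator X (- c + 2 * x) \<partial>lborel) = (\<integral>\<^sup>+x. indicator {t. - c + 2 * t \<in> X} x \<partial>lborel)"
    by (intro nn_integral_cong) (auto simp: indicator_def)
  also have "\<dots> = emeasure lborel {t. - c + 2 * t \<in> X}"
    by (rule nn_integral_indicator) measurable
  finally show ?thesis .
qed

text \<open>Cut \<open>A\<close> above at one of its points a, and \<open>C\<close> below at one of
  its points c. The sets (A + c) / 2 and (a + C) / 2 then both lie in \<open>D\<close>, on opposite
  sides of (a + c) / 2, and share at most this point, so their lengths add up. Suprema over a and c
  undo the cuts; they range over nonempty sets by \<open>ne\<close>.\<close>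

lemma brunn_minkowski_real:
  fixes A C D :: "real set"
  assumes [measurable]: "A \<in> sets borel" "C \<in> sets borel" "D \<in> sets borel"
    and ne: "A \<noteq> {}" "C \<noteq> {}" and mid: "\<And>x y. x \<in> A \<Longrightarrow> y \<in> C \<Longrightarrow> (x + y) / 2 \<in> D"
  shows "emeasure lborel A + emeasure lborel C \<le> 2 * emeasure lborel D"
proof -
  have cut: "emeasure lborel (A \<inter> {..a}) + emeasure lborel (C \<inter> {c..}) \<le> 2 * emeasure lborel D"
    if a: "a \<in> A" and c: "c \<in> C" for a c
  proof -
    define X where "X = {t. - c + 2 * t \<in> A \<inter> {..a}}"
    define Y where "Y = {t. - a + 2 * t \<in> C \<inter> {c..}}"
    have [measurable]: "X \<in> sets borel" "Y \<in> sets borel" unfolding X_def Y_def by measurable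
    have "X \<subseteq> D" using mid[OF _ c] by (fastforce simp: X_def)
    moreover have "Y \<subseteq> D" using mid[OF a] by (fastforce simp: Y_def)
    ultimately have XY: "X \<union> (Y - {(a + c) / 2}) \<subseteq> D" by blast
    have disj: "X \<inter> (Y - {(a + c) / 2}) = {}" by (auto simp: X_def Y_def)
    have "emeasure lborel Y = emeasure lborel (Y - {(a + c) / 2})"
      by (rule emeasure_Diff_null_set[symmetric]) auto
    then have "emeasure lborel X + emeasure lborel Y = emeasure lborel (X \<union> (Y - {(a + c) / 2}))"
      using disj by (simp add: plus_emeasure)
    also have "\<dots> \<le> emeasure lborel D" using XY by (rule emeasure_mono) simp
    finally have "2 * (emeasure lborel X + emeasure lborel Y) \<le> 2 * emeasure lborel D"
      by (rule mult_left_mono) simp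
    then show ?thesis
      using emeasure_lborel_double_vimage[of "A \<inter> {..a}" c] emeasure_lborel_double_vimage[of "C \<inter> {c..}" a]
      by (simp add: X_def Y_def distrib_left)
  qed
  have "emeasure lborel A + emeasure lborel C
      \<le> (SUP a\<in>A. emeasure lborel (A \<inter> {..a})) + (SUP c\<in>C. emeasure lborel (C \<inter> {c..}))"
    by (intro add_mono emeasure_le_SUP_atMost emeasure_le_SUP_atLeast ne) auto
  also have "\<dots> \<le> 2 * emeasure lborel D"
  proof -
    have "emeasure lborel (A \<inter> {..a}) + (SUP c\<in>C. emeasure lborel (C \<inter> {c..})) \<le> 2 * emeasure lborel D"
      if "a \<in> A" for a
      by (subst ennreal_SUP_add_right[OF ne(2)]) (auto intro!: SUP_least cut that)
    then show ?thesis
      by (subst ennreal_SUP_add_left[OF ne(1), symmetric]) (auto intro!: SUP_least)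
  qed
  finally show ?thesis .
qed

section \<open>The Prekopa-Leindler inequality on the line\<close>

lemma nn_integral_layer:
  fixes u :: "real \<Rightarrow> ennreal"
  assumes [measurable]: "u \<in> borel_measurable borel"
  shows "(\<integral>\<^sup>+l. emeasure lborel {x. ennreal l < u x} * indicator {0<..<1::real} l \<partial>lborel)
    = (\<integral>\<^sup>+x. min (u x) 1 \<partial>lborel)"
proof -
  have "(\<integral>\<^sup>+l. emeasure lborel {x. ennreal l < u x} * indicator {0<..<1::real} l \<partial>lborel)
      = (\<integral>\<^sup>+l. (\<integral>\<^sup>+x. indicator {p. ennreal (fst p) < u (snd p) \<and> fst p \<in> {0<..<1}} (l, x) \<partial>lborel) \<partial>lborel)"
  proof (intro nn_integral_cong)
    fix l :: real
    have "(\<integral>\<^sup>+x. indicator {p. ennreal (fst p) < u (snd p) \<and> fst p \<in> {0<..<1}} (l, x) \<partial>lborel)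
        = (\<integral>\<^sup>+x. indicator {x. ennreal l < u x} x * indicator {0<..<1} l \<partial>lborel)"
      by (intro nn_integral_cong) (auto simp: indicator_def)
    also have "\<dots> = emeasure lborel {x. ennreal l < u x} * indicator {0<..<1} l"
      by (subst nn_integral_multc) (auto simp: mult.commute)
    finally show "emeasure lborel {x. ennreal l < u x} * indicator {0<..<1} l
      = (\<integral>\<^sup>+x. indicator {p. ennreal (fst p) < u (snd p) \<and> fst p \<in> {0<..<1}} (l, x) \<partial>lborel)" ..
  qed
  \<comment> \<open>Fubini for the region below the graph of \<open>u\<close>. Keeping only the
    levels between 0 and 1 truncates \<open>u\<close> at 1.\<close>
  also have "\<dots> = (\<integral>\<^sup>+x. (\<integral>\<^sup>+l. indicator {p. ennreal (fst p) < u (snd p) \<and> fst p \<in> {0<..<1}} (l, x) \<partial>lborel) \<partial>lborel)"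
    by (rule lborel_pair.Fubini'[symmetric]) measurable
  also have "\<dots> = (\<integral>\<^sup>+x. min (u x) 1 \<partial>lborel)"
  proof (intro nn_integral_cong)
    fix x
    have "(\<integral>\<^sup>+l. indicator {p. ennreal (fst p) < u (snd p) \<and> fst p \<in> {0<..<1}} (l, x) \<partial>lborel)
        = (\<integral>\<^sup>+l. indicator {l. ennreal l < u x \<and> l \<in> {0<..<1}} l \<partial>lborel)"
      by (intro nn_integral_cong) (auto simp: indicator_def)
    also have "\<dots> = emeasure lborel {l. ennreal l < u x \<and> l \<in> {0<..<1}}"
      by (rule nn_integral_indicator) measurable
    also have "\<dots> = min (u x) 1"
    proof (cases "u x \<le> 1")
      case True
      then obtain r where r: "u x = ennreal r" "0 \<le> r" "r \<le> 1" by (cases "u x") (auto simp: top_unique)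
      have "{l. ennreal l < u x \<and> l \<in> {0<..<1}} = {0<..<r}"
        using r by (auto simp: ennreal_less_iff)
      then show ?thesis using r True by (simp add: min_def)
    next
      case False
      then have "1 < u x" by simp
      then have "ennreal l < u x" if "l < 1" for l using that by (simp add: less_trans[of "ennreal l" 1])
      then have "{l. ennreal l < u x \<and> l \<in> {0<..<1}} = {0<..<1}"
        by auto
      then show ?thesis using False by (simp add: min_def)
    qed
    finally show "(\<integral>\<^sup>+l. indicator {p. ennreal (fst p) < u (snd p) \<and> fst p \<in> {0<..<1}} (l, x) \<partial>lborel) = min (u x) 1" .
  qed
  finally show ?thesis .
qed

text \<open>For 0 < l < 1, f x > l and g y > l force h((x + y) / 2) > l, so the superlevel sets
  satisfy the hypothesis of \<open>brunn_minkowski_real\<close>; integration over l gives the claim.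
  Equal suprema guarantee that the superlevel sets of \<open>f\<close> and \<open>g\<close> are
  nonempty for the same levels.\<close>

lemma prekopa_leindler_real_normalized:
  fixes f g h :: "real \<Rightarrow> ennreal"
  assumes [measurable]: "f \<in> borel_measurable borel" "g \<in> borel_measurable borel" "h \<in> borel_measurable borel"
    and sup: "(SUP x. f x) = 1" "(SUP x. g x) = 1"
    and mid: "\<And>x y. f x * g y \<le> (h ((x + y) / 2))\<^sup>2"
  shows "(\<integral>\<^sup>+x. f x \<partial>lborel) + (\<integral>\<^sup>+x. g x \<partial>lborel) \<le> 2 * (\<integral>\<^sup>+x. h x \<partial>lborel)"
proof -
  define L where "L u l = emeasure lborel {x. ennreal l < u x} * indicator {0<..<1::real} l" for u :: "real \<Rightarrow> ennreal" and l
  have [measurable]: "L u \<in> borel_measurable borel" if [measurable]: "u \<in> borel_measurable borel" for u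
  proof -
    have "(\<lambda>l. emeasure lborel {x. ennreal l < u x}) = (\<lambda>l. \<integral>\<^sup>+x. indicator {p. ennreal (fst p) < u (snd p)} (l, x) \<partial>lborel)"
    proof
      fix l
      have "(\<integral>\<^sup>+x. indicator {p. ennreal (fst p) < u (snd p)} (l, x) \<partial>lborel) = (\<integral>\<^sup>+x. indicator {x. ennreal l < u x} x \<partial>lborel)"
        by (intro nn_integral_cong) (auto simp: indicator_def)
      then show "emeasure lborel {x. ennreal l < u x} = (\<integral>\<^sup>+x. indicator {p. ennreal (fst p) < u (snd p)} (l, x) \<partial>lborel)"
        by simp
    qed
    also have "\<dots> \<in> borel_measurable borel" by measurable
    finally show ?thesis unfolding L_def[abs_def] by measurable
  qed
  have le1: "f x \<le> 1" "g x \<le> 1" for x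
    using SUP_upper[of x UNIV f] SUP_upper[of x UNIV g] sup by auto
  have level: "L f l + L g l \<le> 2 * L h l" for l
  proof (cases "l \<in> {0<..<1}")
    case True
    then have l: "0 < l" "ennreal l < 1" by auto
    have "emeasure lborel {x. ennreal l < f x} + emeasure lborel {x. ennreal l < g x}
        \<le> 2 * emeasure lborel {x. ennreal l < h x}"
    proof (rule brunn_minkowski_real)
      show "{x. ennreal l < f x} \<noteq> {}" "{x. ennreal l < g x} \<noteq> {}"
        using l(2) less_SUP_iff[of "ennreal l" f UNIV] less_SUP_iff[of "ennreal l" g UNIV] by (auto simp: sup)
      fix x y assume "x \<in> {x. ennreal l < f x}" "y \<in> {x. ennreal l < g x}"
      then have xy: "ennreal l < f x" "ennreal l < g y" by auto
      obtain p q where p: "f x = ennreal p" "0 \<le> p" and q: "g y = ennreal q" "0 \<le> q"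
        using le1[of x] le1[of y] by (cases "f x"; cases "g y") (auto simp: top_unique)
      have "l < p" "l < q" using xy p q l by (auto simp: ennreal_less_iff)
      then have lt: "l * l < p * q" using l by (intro mult_strict_mono) auto
      show "(x + y) / 2 \<in> {x. ennreal l < h x}"
      proof (rule ccontr)
        assume "(x + y) / 2 \<notin> {x. ennreal l < h x}"
        then have "(h ((x + y) / 2))\<^sup>2 \<le> (ennreal l)\<^sup>2" by (intro power_mono) auto
        then have "ennreal (p * q) \<le> ennreal (l * l)"
          using order_trans[OF mid[of x y]] p q l by (simp add: ennreal_mult power2_eq_square)
        then show False using lt l by (simp add: ennreal_le_iff)
      qed
    qed measurable
    then show ?thesis using True by (simp add: L_def)
  qed (simp add: L_def)
  have "(\<integral>\<^sup>+x. f x \<partial>lborel) + (\<integral>\<^sup>+x. g x \<partial>lborel) = (\<integral>\<^sup>+l. L f l \<partial>lborel) + (\<integral>\<^sup>+l. L g l \<partial>lborel)"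
    using le1 by (simp add: L_def nn_integral_layer min_absorb1)
  also have "\<dots> = (\<integral>\<^sup>+l. L f l + L g l \<partial>lborel)" by (rule nn_integral_add[symmetric]) measurable
  also have "\<dots> \<le> (\<integral>\<^sup>+l. 2 * L h l \<partial>lborel)" by (intro nn_integral_mono level)
  also have "\<dots> = 2 * (\<integral>\<^sup>+l. L h l \<partial>lborel)" by (rule nn_integral_cmult) measurable
  also have "(\<integral>\<^sup>+l. L h l \<partial>lborel) = (\<integral>\<^sup>+x. min (h x) 1 \<partial>lborel)" by (simp add: L_def nn_integral_layer)
  \<comment> \<open>Only levels below 1 were counted, while \<open>h\<close> may exceed 1; the
    inequality has the right direction.\<close>
  also have "\<dots> \<le> (\<integral>\<^sup>+x. h x \<partial>lborel)" by (intro nn_integral_mono) auto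
  finally show ?thesis by (simp add: mult_left_mono)
qed

lemma ennreal_am_gm:
  fixes a b c :: ennreal
  assumes "a + b \<le> 2 * c"
  shows "a * b \<le> c\<^sup>2"
proof (cases "c = top")
  case False
  then have "2 * c < top" by (simp add: ennreal_mult_less_top less_top)
  with assms have "a + b < top" by (rule le_less_trans)
  then have "a \<noteq> top" "b \<noteq> top" by auto
  with False obtain p q r where pqr: "a = ennreal p" "b = ennreal q" "c = ennreal r" "0 \<le> p" "0 \<le> q" "0 \<le> r"
    by (cases a; cases b; cases c) auto
  then have "ennreal (p + q) \<le> ennreal (2 * r)" using assms by (simp add: ennreal_mult)
  then have "p + q \<le> 2 * r" using pqr by (subst (asm) ennreal_le_iff) auto
  then have "(p + q)\<^sup>2 \<le> (2 * r)\<^sup>2" using pqr by (intro power_mono) auto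
  moreover have "4 * (p * q) \<le> (p + q)\<^sup>2" using zero_le_power2[of "p - q"] by (simp add: power2_eq_square algebra_simps)
  ultimately have "p * q \<le> r\<^sup>2" by (simp add: power2_eq_square)
  then show ?thesis using pqr by (simp add: ennreal_mult[symmetric] ennreal_power)
qed (simp add: power2_eq_square)

text \<open>Dividing \<open>f\<close>, \<open>g\<close>, \<open>h\<close> by the suprema a, b and by
  their geometric mean c preserves \<open>mid\<close> and reduces to the normalized case; the
  inequality between arithmetic and geometric means makes its conclusion multiplicative. The bound
  \<open>M\<close> keeps a and b finite, and a vanishing supremum makes the left side 0.\<close>

lemma prekopa_leindler_real:
  fixes f g h :: "real \<Rightarrow> ennreal"
  assumes [measurable]: "f \<in> borel_measurable borel" "g \<in> borel_measurable borel" "h \<in> borel_measurable borel"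
    and bdd: "\<And>x. f x \<le> ennreal M" "\<And>x. g x \<le> ennreal M"
    and mid: "\<And>x y. f x * g y \<le> (h ((x + y) / 2))\<^sup>2"
  shows "(\<integral>\<^sup>+x. f x \<partial>lborel) * (\<integral>\<^sup>+x. g x \<partial>lborel) \<le> (\<integral>\<^sup>+x. h x \<partial>lborel)\<^sup>2"
proof (cases "(SUP x. f x) = 0 \<or> (SUP x. g x) = 0")
  case True
  then have "(\<forall>x. f x = 0) \<or> (\<forall>x. g x = 0)"
    by (auto simp: SUP_eq_iff)
  then show ?thesis by auto
next
  case False
  have "(SUP x. f x) \<le> ennreal M" "(SUP x. g x) \<le> ennreal M" using bdd by (auto intro: SUP_least)
  with False obtain a b where ab: "(SUP x. f x) = ennreal a" "(SUP x. g x) = ennreal b" "0 < a" "0 < b"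
    by (cases "SUP x. f x"; cases "SUP x. g x") (auto simp: top_unique le_less)
  define c where "c = sqrt (a * b)"
  have c: "0 < c" "c\<^sup>2 = a * b" using ab by (auto simp: c_def)
  have inv: "ennreal (1 / a) * ennreal a = 1" "ennreal (1 / b) * ennreal b = 1"
    using ab by (simp_all add: ennreal_mult[symmetric])
  have one: "(ennreal c)\<^sup>2 * (ennreal (1 / c))\<^sup>2 = 1"
  proof -
    have "ennreal c * ennreal (1 / c) = 1" using c by (simp add: ennreal_mult[symmetric])
    then show ?thesis by (simp only: power_mult_distrib[symmetric] power_one)
  qed
  have cc: "(ennreal (1 / c))\<^sup>2 = ennreal (1 / a) * ennreal (1 / b)"
    using ab c by (simp add: ennreal_mult[symmetric] ennreal_power power_divide)
  have "(\<integral>\<^sup>+x. ennreal (1 / a) * f x \<partial>lborel) + (\<integral>\<^sup>+x. ennreal (1 / b) * g x \<partial>lborel)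
      \<le> 2 * (\<integral>\<^sup>+x. ennreal (1 / c) * h x \<partial>lborel)"
  proof (rule prekopa_leindler_real_normalized)
    show "(SUP x. ennreal (1 / a) * f x) = 1" "(SUP x. ennreal (1 / b) * g x) = 1"
      using inv by (simp_all add: SUP_mult_left_ennreal[symmetric] ab)
    fix x y
    have "ennreal (1 / a) * f x * (ennreal (1 / b) * g y) = (ennreal (1 / c))\<^sup>2 * (f x * g y)"
      by (simp add: cc ac_simps)
    also have "\<dots> \<le> (ennreal (1 / c))\<^sup>2 * (h ((x + y) / 2))\<^sup>2" by (intro mult_left_mono mid) simp
    finally show "ennreal (1 / a) * f x * (ennreal (1 / b) * g y) \<le> (ennreal (1 / c) * h ((x + y) / 2))\<^sup>2"
      by (simp add: power_mult_distrib)
  qed measurable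
  then have "(ennreal (1 / a) * (\<integral>\<^sup>+x. f x \<partial>lborel)) * (ennreal (1 / b) * (\<integral>\<^sup>+x. g x \<partial>lborel))
      \<le> (ennreal (1 / c) * (\<integral>\<^sup>+x. h x \<partial>lborel))\<^sup>2"
    by (intro ennreal_am_gm) (simp add: nn_integral_cmult)
  then have "(ennreal (1 / c))\<^sup>2 * ((\<integral>\<^sup>+x. f x \<partial>lborel) * (\<integral>\<^sup>+x. g x \<partial>lborel))
      \<le> (ennreal (1 / c))\<^sup>2 * (\<integral>\<^sup>+x. h x \<partial>lborel)\<^sup>2"
    by (simp add: cc power_mult_distrib ac_simps)
  then have "(ennreal c)\<^sup>2 * ((ennreal (1 / c))\<^sup>2 * ((\<integral>\<^sup>+x. f x \<partial>lborel) * (\<integral>\<^sup>+x. g x \<partial>lborel)))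
      \<le> (ennreal c)\<^sup>2 * ((ennreal (1 / c))\<^sup>2 * (\<integral>\<^sup>+x. h x \<partial>lborel)\<^sup>2)"
    by (rule mult_left_mono) simp
  then show ?thesis
    by (simp only: mult.assoc[symmetric, of "(ennreal c)\<^sup>2"] one mult_1_left)
qed

text \<open>Induction on the coordinates: the sections of \<open>A\<close> at s, \<open>C\<close> at
  t and \<open>D\<close> at (s + t) / 2 satisfy the induction hypothesis, and its conclusion is
  exactly the hypothesis of Prekopa-Leindler for the volumes of the sections. The common cube makes
  these volumes bounded functions of the height.\<close>

lemma brunn_minkowski_PiM:
  fixes A C D :: "('i \<Rightarrow> real) set" and R :: real
  assumes "finite I" "A \<in> sets (PiM I (\<lambda>_. lborel))" "C \<in> sets (PiM I (\<lambda>_. lborel))" "D \<in> sets (PiM I (\<lambda>_. lborel))"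
    and "A \<subseteq> I \<rightarrow>\<^sub>E {-R..R}" "C \<subseteq> I \<rightarrow>\<^sub>E {-R..R}"
    and "\<And>x y. x \<in> A \<Longrightarrow> y \<in> C \<Longrightarrow> (\<lambda>i\<in>I. (x i + y i) / 2) \<in> D"
  shows "emeasure (PiM I (\<lambda>_. lborel)) A * emeasure (PiM I (\<lambda>_. lborel)) C
    \<le> (emeasure (PiM I (\<lambda>_. lborel)) D)\<^sup>2"
  using assms
proof (induction I arbitrary: A C D rule: finite_induct)
  case empty
  then have "A \<subseteq> {\<lambda>_. undefined}" "C \<subseteq> {\<lambda>_. undefined}" "D \<subseteq> {\<lambda>_. undefined}"
    by (auto simp: PiM_empty)
  moreover have "(\<lambda>_. undefined) \<in> D" if "x \<in> A" "y \<in> C" for x y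
    using empty(6)[OF that] by (simp add: restrict_def)
  \<comment> \<open>Without coordinates the space is a single point of mass 1: either a factor on
    the left is empty or all three sets are the whole space.\<close>
  ultimately have "A = {} \<or> C = {} \<or> A = {\<lambda>_. undefined} \<and> C = {\<lambda>_. undefined} \<and> D = {\<lambda>_. undefined}"
    by blast
  then show ?case
    by (auto simp: PiM_empty)
next
  case (insert i I)
  interpret P: product_sigma_finite "\<lambda>_::'i. lborel :: real measure" ..
  interpret PI: sigma_finite_measure "PiM I (\<lambda>_. lborel :: real measure)"
    using insert(1) by (rule P.sigma_finite)
  let ?P = "PiM I (\<lambda>_. lborel :: real measure)" and ?Q = "PiM (insert i I) (\<lambda>_. lborel :: real measure)"
  define S where "S X s = {x \<in> space ?P. x(i := s) \<in> X}" for X s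
  have upd: "(\<lambda>p. (snd p)(i := fst p)) \<in> lborel \<Otimes>\<^sub>M ?P \<rightarrow>\<^sub>M ?Q"
    by measurable
  have updx: "(\<lambda>x. x(i := s)) \<in> ?P \<rightarrow>\<^sub>M ?Q" for s
    by measurable
  have S_sets: "S X s \<in> sets ?P" if "X \<in> sets ?Q" for X s
    using measurable_sets[OF updx that, of s] by (simp add: S_def vimage_def Int_def conj_commute)
  have S_eq: "emeasure ?P (S X s) = (\<integral>\<^sup>+x. indicator X (x(i := s)) \<partial>?P)" if "X \<in> sets ?Q" for X s
  proof -
    have "emeasure ?P (S X s) = (\<integral>\<^sup>+x. indicator (S X s) x \<partial>?P)"
      using S_sets[OF that] by simp
    also have "\<dots> = (\<integral>\<^sup>+x. indicator X (x(i := s)) \<partial>?P)"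
      by (intro nn_integral_cong) (auto simp: S_def indicator_def)
    finally show ?thesis .
  qed
  have S_meas: "(\<lambda>s. emeasure ?P (S X s)) \<in> borel_measurable borel" if X: "X \<in> sets ?Q" for X
  proof -
    have "(\<lambda>p. indicator X ((snd p)(i := fst p)) :: ennreal) \<in> borel_measurable (lborel \<Otimes>\<^sub>M ?P)"
      using measurable_compose[OF upd, of "indicator X"] X by (simp add: borel_measurable_indicator)
    then have "(\<lambda>s. \<integral>\<^sup>+x. indicator X (x(i := s)) \<partial>?P) \<in> borel_measurable lborel"
      by (intro PI.borel_measurable_nn_integral) (simp add: case_prod_unfold)
    then show ?thesis using S_eq[OF X] by simp
  qed
  have S_int: "emeasure ?Q X = (\<integral>\<^sup>+s. emeasure ?P (S X s) \<partial>lborel)" if X: "X \<in> sets ?Q" for X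
  proof -
    have "emeasure ?Q X = (\<integral>\<^sup>+x. indicator X x \<partial>?Q)" using X by simp
    also have "\<dots> = (\<integral>\<^sup>+s. (\<integral>\<^sup>+x. indicator X (x(i := s)) \<partial>?P) \<partial>lborel)"
      using insert(1,2) X by (intro P.product_nn_integral_insert_rev) auto
    finally show ?thesis using S_eq[OF X] by simp
  qed
  have cube: "S X s \<subseteq> I \<rightarrow>\<^sub>E {-R..R}" if "X \<subseteq> insert i I \<rightarrow>\<^sub>E {-R..R}" for X s
  proof
    fix x assume "x \<in> S X s"
    then have x: "x \<in> extensional I" "x(i := s) \<in> insert i I \<rightarrow>\<^sub>E {-R..R}"
      using that by (auto simp: S_def space_PiM PiE_def)
    have "x j \<in> {-R..R}" if "j \<in> I" for j
      using PiE_mem[OF x(2), of j] that insert(2) by (auto split: if_splits)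
    then show "x \<in> I \<rightarrow>\<^sub>E {-R..R}" using x(1) by (auto simp: PiE_def)
  qed
  \<comment> \<open>For negative \<open>R\<close> the interval is empty, which the conditional
    records.\<close>
  define M where "M = (if - R \<le> R then R - - R else 0) ^ card I"
  have bdd: "emeasure ?P (S X s) \<le> ennreal M" if "X \<subseteq> insert i I \<rightarrow>\<^sub>E {-R..R}" for X s
  proof -
    have "emeasure ?P (S X s) \<le> emeasure ?P (I \<rightarrow>\<^sub>E {-R..R})"
      using cube[OF that] insert(1) by (intro emeasure_mono sets_PiM_I_finite) auto
    also have "\<dots> = (\<Prod>j\<in>I. emeasure lborel {-R..R})"
      using insert(1) by (intro P.emeasure_PiM) auto
    also have "\<dots> = ennreal M" by (simp add: M_def emeasure_lborel_Icc_eq ennreal_power)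
    finally show ?thesis .
  qed
  have "(\<integral>\<^sup>+s. emeasure ?P (S A s) \<partial>lborel) * (\<integral>\<^sup>+s. emeasure ?P (S C s) \<partial>lborel)
      \<le> (\<integral>\<^sup>+s. emeasure ?P (S D s) \<partial>lborel)\<^sup>2"
  proof (rule prekopa_leindler_real)
    fix s t
    show "emeasure ?P (S A s) * emeasure ?P (S C t) \<le> (emeasure ?P (S D ((s + t) / 2)))\<^sup>2"
    proof (rule insert.IH)
      fix x y assume x: "x \<in> S A s" and y: "y \<in> S C t"
      have "(\<lambda>j\<in>insert i I. ((x(i := s)) j + (y(i := t)) j) / 2) \<in> D"
        using insert.prems(6)[of "x(i := s)" "y(i := t)"] x y unfolding S_def by blast
      moreover have "(\<lambda>j\<in>insert i I. ((x(i := s)) j + (y(i := t)) j) / 2)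
          = (\<lambda>j\<in>I. (x j + y j) / 2)(i := (s + t) / 2)"
        using insert(2) by (auto simp: fun_eq_iff)
      ultimately show "(\<lambda>j\<in>I. (x j + y j) / 2) \<in> S D ((s + t) / 2)"
        by (simp add: S_def space_PiM)
    qed (use S_sets cube insert.prems in auto)
  qed (use S_meas bdd insert.prems in auto)
  then show ?case using S_int insert.prems by simp
qed

lemma brunn_minkowski_lborel:
  fixes A C D :: "'a::euclidean_space set"
  assumes A: "A \<in> sets borel" "bounded A" and C: "C \<in> sets borel" "bounded C" and D: "D \<in> sets borel"
    and mid: "\<And>x y. x \<in> A \<Longrightarrow> y \<in> C \<Longrightarrow> midpoint x y \<in> D"
  shows "emeasure lborel A * emeasure lborel C \<le> (emeasure lborel D)\<^sup>2"
proof -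
  let ?P = "PiM (Basis :: 'a set) (\<lambda>_. lborel :: real measure)"
  define f where "f = (\<lambda>y. \<Sum>b\<in>Basis. y b *\<^sub>R b :: 'a)"
  have f[measurable]: "f \<in> ?P \<rightarrow>\<^sub>M borel" unfolding f_def by measurable
  have eq: "emeasure lborel X = emeasure ?P (f -` X \<inter> space ?P)" if "X \<in> sets borel" for X
    by (subst lborel_eq) (simp add: that f_def[symmetric] emeasure_distr)
  have meas: "f -` X \<inter> space ?P \<in> sets ?P" if "X \<in> sets borel" for X
    using measurable_sets[OF f that] .
  obtain R where R: "\<And>x. x \<in> A \<union> C \<Longrightarrow> norm x \<le> R"
    using A C bounded_Un[of A C] by (auto simp: bounded_iff)
  have f_inner: "f y \<bullet> b = y b" if "b \<in> Basis" for y b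
    using that by (simp add: f_def inner_sum_left inner_Basis if_distrib[of "\<lambda>x. _ * x"] cong: if_cong)
  have cube: "f -` X \<inter> space ?P \<subseteq> Basis \<rightarrow>\<^sub>E {-R..R}" if "X \<subseteq> A \<union> C" for X
  proof
    fix y assume y: "y \<in> f -` X \<inter> space ?P"
    have "y b \<in> {-R..R}" if b: "b \<in> Basis" for b
      using Basis_le_norm[OF b, of "f y"] R[of "f y"] y \<open>X \<subseteq> A \<union> C\<close> by (auto simp: f_inner[OF b] abs_le_iff)
    then show "y \<in> Basis \<rightarrow>\<^sub>E {-R..R}" using y by (auto simp: space_PiM PiE_def)
  qed
  have "emeasure ?P (f -` A \<inter> space ?P) * emeasure ?P (f -` C \<inter> space ?P) \<le> (emeasure ?P (f -` D \<inter> space ?P))\<^sup>2"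
  proof (rule brunn_minkowski_PiM)
    fix x y assume "x \<in> f -` A \<inter> space ?P" "y \<in> f -` C \<inter> space ?P"
    then have "midpoint (f x) (f y) \<in> D" using mid by blast
    also have "midpoint (f x) (f y) = f (\<lambda>i\<in>Basis. (x i + y i) / 2)"
      by (simp add: f_def midpoint_def scaleR_sum_right sum.distrib[symmetric] algebra_simps add_divide_distrib)
    finally show "(\<lambda>i\<in>Basis. (x i + y i) / 2) \<in> f -` D \<inter> space ?P" by (simp add: space_PiM)
  qed (use meas cube A C D in auto)
  then show ?thesis using A C D by (simp add: eq)
qed

subsection \<open>Triangular maps preserve Lebesgue measure\<close>

lemma nn_integral_lborel_split_Basis:
  fixes u :: "'a::euclidean_space \<Rightarrow> ennreal"
  assumes [measurable]: "u \<in> borel_measurable borel" and b: "b \<in> Basis"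
  shows "(\<integral>\<^sup>+x. u x \<partial>lborel)
    = (\<integral>\<^sup>+y. (\<integral>\<^sup>+s. u ((\<Sum>c\<in>Basis - {b}. y c *\<^sub>R c) + s *\<^sub>R b) \<partial>lborel) \<partial>(\<Pi>\<^sub>M c\<in>Basis - {b}. lborel))"
proof -
  interpret P: product_sigma_finite "\<lambda>_::'a. lborel :: real measure" ..
  let ?f = "\<lambda>y. \<Sum>c\<in>Basis. y c *\<^sub>R c :: 'a"
  have upd: "?f (y(b := s)) = (\<Sum>c\<in>Basis - {b}. y c *\<^sub>R c) + s *\<^sub>R b" for y s
    using b by (subst sum.remove[of _ b]) (auto simp: add.commute intro!: sum.cong)
  have ins: "insert b (Basis - {b}) = Basis" using b by auto
  have "(\<integral>\<^sup>+x. u x \<partial>lborel) = (\<integral>\<^sup>+y. u (?f y) \<partial>(\<Pi>\<^sub>M c\<in>Basis. lborel))"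
    by (subst lborel_eq) (simp add: nn_integral_distr)
  also have "\<dots> = (\<integral>\<^sup>+y. u (?f y) \<partial>(\<Pi>\<^sub>M c\<in>insert b (Basis - {b}). lborel))"
    by (simp only: ins)
  also have "\<dots> = (\<integral>\<^sup>+y. (\<integral>\<^sup>+s. u (?f (y(b := s))) \<partial>lborel) \<partial>(\<Pi>\<^sub>M c\<in>Basis - {b}. lborel))"
  proof (rule P.product_nn_integral_insert)
    have "(\<lambda>y. u (?f y)) \<in> borel_measurable (\<Pi>\<^sub>M c\<in>Basis. lborel)" by measurable
    then show "(\<lambda>y. u (?f y)) \<in> borel_measurable (\<Pi>\<^sub>M c\<in>insert b (Basis - {b}). lborel)"
      by (simp only: ins)
  qed auto
  finally show ?thesis by (simp only: upd)
qed

text \<open>By \<open>q\<close>, the map is a translation on each line parallel to \<open>b\<close>,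
  so Fubini with \<open>b\<close> as inner variable reduces the claim to translation invariance on
  the line.\<close>

lemma lborel_distr_shear:
  fixes q :: "'a::euclidean_space \<Rightarrow> real"
  assumes [measurable]: "q \<in> borel_measurable borel" and b: "b \<in> Basis"
    and q: "\<And>x s. q (x + s *\<^sub>R b) = q x"
  shows "distr lborel borel (\<lambda>x. x + q x *\<^sub>R b) = lborel"
proof (rule measure_eqI)
  fix X assume "X \<in> sets (distr lborel borel (\<lambda>x. x + q x *\<^sub>R b))"
  then have [measurable]: "X \<in> sets borel" by simp
  let ?p = "\<lambda>y. \<Sum>c\<in>Basis - {b}. y c *\<^sub>R c :: 'a"
  have "emeasure (distr lborel borel (\<lambda>x. x + q x *\<^sub>R b)) X
      = (\<integral>\<^sup>+x. indicator X x \<partial>distr lborel borel (\<lambda>x. x + q x *\<^sub>R b))" by simp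
  also have "\<dots> = (\<integral>\<^sup>+x. indicator X (x + q x *\<^sub>R b) \<partial>lborel)"
    by (rule nn_integral_distr) measurable
  also have "\<dots> = (\<integral>\<^sup>+y. (\<integral>\<^sup>+s. indicator X (?p y + s *\<^sub>R b + q (?p y + s *\<^sub>R b) *\<^sub>R b) \<partial>lborel) \<partial>(\<Pi>\<^sub>M c\<in>Basis - {b}. lborel))"
    by (rule nn_integral_lborel_split_Basis[OF _ b]) measurable
  also have "\<dots> = (\<integral>\<^sup>+y. (\<integral>\<^sup>+s. indicator X (?p y + s *\<^sub>R b) \<partial>lborel) \<partial>(\<Pi>\<^sub>M c\<in>Basis - {b}. lborel))"
  proof (rule nn_integral_cong)
    fix y
    have "?p y + s *\<^sub>R b + q (?p y + s *\<^sub>R b) *\<^sub>R b = ?p y + (q (?p y) + 1 * s) *\<^sub>R b" for s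
      by (simp add: q scaleR_left_distrib)
    moreover have "(\<integral>\<^sup>+s. (indicator X (?p y + (q (?p y) + 1 * s) *\<^sub>R b) :: ennreal) \<partial>lborel)
        = (\<integral>\<^sup>+s. indicator X (?p y + s *\<^sub>R b) \<partial>lborel)"
      by (subst (2) nn_integral_real_affine[of _ 1 "q (?p y)"]) auto
    ultimately show "(\<integral>\<^sup>+s. indicator X (?p y + s *\<^sub>R b + q (?p y + s *\<^sub>R b) *\<^sub>R b) \<partial>lborel)
        = (\<integral>\<^sup>+s. (indicator X (?p y + s *\<^sub>R b) :: ennreal) \<partial>lborel)"
      by (simp only:)
  qed
  also have "\<dots> = (\<integral>\<^sup>+x. indicator X x \<partial>lborel)"
    by (rule nn_integral_lborel_split_Basis[OF _ b, symmetric]) measurable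
  finally show "emeasure (distr lborel borel (\<lambda>x. x + q x *\<^sub>R b)) X = emeasure lborel X" by simp
qed simp

text \<open>The map is a composition of shears. The rank condition includes c = a and ties: a
  coefficient depends neither on its own coordinate nor on others of equal rank, so the diagonal is
  1 and the order within a rank is irrelevant. The induction inserts elements of maximal
  rank.\<close>

lemma lborel_distr_triangular:
  fixes q :: "'a::euclidean_space \<Rightarrow> 'a \<Rightarrow> real" and rk :: "'a \<Rightarrow> nat"
  assumes "finite A" "A \<subseteq> Basis" and "\<And>a. a \<in> A \<Longrightarrow> q a \<in> borel_measurable borel"
    and "\<And>a c x s. a \<in> A \<Longrightarrow> c \<in> A \<Longrightarrow> rk a \<le> rk c \<Longrightarrow> q a (x + s *\<^sub>R c) = q a x"
  shows "distr lborel borel (\<lambda>x. x + (\<Sum>a\<in>A. q a x *\<^sub>R a)) = lborel"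
  using assms
proof (induction A rule: finite_ranking_induct[where f = rk])
  case empty
  show ?case by (simp add: distr_id2)
next
  case (insert b A)
  show ?case
  proof (cases "b \<in> A")
    case True
    with insert show ?thesis by (simp add: insert_absorb)
  next
    case False
    have [measurable]: "q a \<in> borel_measurable borel" if "a \<in> insert b A" for a
      using insert.prems that by blast
    have [measurable]: "q b \<in> borel_measurable borel" by simp
    \<comment> \<open>Shearing first along the direction of highest rank leaves the coefficients of the others unchanged.\<close>
    let ?S = "\<lambda>x. x + q b x *\<^sub>R b" and ?T = "\<lambda>x. x + (\<Sum>a\<in>A. q a x *\<^sub>R a)"
    have [measurable]: "?T \<in> borel_measurable borel"
      by (intro borel_measurable_add borel_measurable_sum borel_measurable_scaleR) auto
    have "?T (?S x) = x + (\<Sum>a\<in>insert b A. q a x *\<^sub>R a)" for x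
    proof -
      have "q a (x + q b x *\<^sub>R b) = q a x" if "a \<in> A" for a
        using that insert.hyps(2) by (intro insert.prems) auto
      then show ?thesis using insert.hyps(1) False by (simp add: algebra_simps)
    qed
    then have "(\<lambda>x. x + (\<Sum>a\<in>insert b A. q a x *\<^sub>R a)) = ?T \<circ> ?S" by (simp add: fun_eq_iff)
    moreover have "distr lborel borel (?T \<circ> ?S) = distr (distr lborel borel ?S) borel ?T"
      by (rule distr_distr[symmetric]) auto
    moreover have "distr lborel borel ?S = lborel"
      using insert.prems by (intro lborel_distr_shear) auto
    moreover have "distr lborel borel ?T = lborel"
      using insert.prems by (intro insert.IH) auto
    ultimately show ?thesis by simp
  qed
qed

subsection \<open>Slices by parallel hyperplanes\<close>

lemma hausdorff_measure_isometry_image: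
  fixes f :: "'a::metric_space \<Rightarrow> 'b::metric_space"
  assumes "\<And>x y. dist (f x) (f y) = dist x y" and gf: "\<And>x. g (f x) = x" and "\<And>x y. dist (g x) (g y) = dist x y"
  shows "hausdorff_measure k (f ` E) = hausdorff_measure k E"
proof (rule antisym)
  show "hausdorff_measure k (f ` E) \<le> hausdorff_measure k E"
    using hausdorff_measure_lipschitz_image[of f 1 k E] assms by simp
  have "g ` f ` E = E" by (simp add: image_image gf)
  then show "hausdorff_measure k E \<le> hausdorff_measure k (f ` E)"
    using hausdorff_measure_lipschitz_image[of g 1 k "f ` E"] assms by simp
qed

lemma hausdorff_measure_translation:
  fixes a :: "'a::real_normed_vector"
  shows "hausdorff_measure k ((\<lambda>x. x + a) ` E) = hausdorff_measure k E"
  by (rule hausdorff_measure_isometry_image[where g = "\<lambda>x. x - a"]) (auto simp: dist_norm)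

lemma compact_hyperplane_Int:
  fixes K :: "'a::euclidean_space set"
  assumes "compact K"
  shows "compact {x \<in> K. x \<bullet> e = t}"
proof -
  have "{x \<in> K. x \<bullet> e = t} = K \<inter> {x. x \<bullet> e = t}" by auto
  moreover have "closed {x. x \<bullet> e = t}" by (intro closed_Collect_eq continuous_intros)
  ultimately show ?thesis using assms by (simp add: compact_Int_closed)
qed

text \<open>The cylinder formula concerns sets in the hyperplane through 0, so the slice at height
  \<open>t\<close> is first moved there by a Euclidean translation.\<close>

lemma hausdorff_measure_slice_translate:
  fixes e :: "'a::euclidean_space"
  assumes e: "e \<in> Basis" and K: "compact K"
  shows "hausdorff_measure (DIM('a) - 1) {x \<in> K. x \<bullet> e = t}
    = hausdorff_measure (DIM('a) - 1) (flat_cube e 0 1) * emeasure lborel (cylinder e {y. y \<bullet> e = 0 \<and> y + t *\<^sub>R e \<in> K})"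
    and "compact {y. y \<bullet> e = 0 \<and> y + t *\<^sub>R e \<in> K}"
proof -
  have eq: "{y. y \<bullet> e = 0 \<and> y + t *\<^sub>R e \<in> K} = (\<lambda>x. x + (- t) *\<^sub>R e) ` {x \<in> K. x \<bullet> e = t}"
  proof (intro equalityI subsetI)
    fix y assume "y \<in> {y. y \<bullet> e = 0 \<and> y + t *\<^sub>R e \<in> K}"
    then show "y \<in> (\<lambda>x. x + (- t) *\<^sub>R e) ` {x \<in> K. x \<bullet> e = t}"
      using e by (intro image_eqI[of _ _ "y + t *\<^sub>R e"]) (auto simp: inner_left_distrib)
  qed (use e in \<open>auto simp: inner_left_distrib inner_diff_left\<close>)
  show c: "compact {y. y \<bullet> e = 0 \<and> y + t *\<^sub>R e \<in> K}"
    unfolding eq by (intro compact_continuous_image compact_hyperplane_Int K continuous_intros)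
  have "hausdorff_measure (DIM('a) - 1) {x \<in> K. x \<bullet> e = t} = hausdorff_measure (DIM('a) - 1) {y. y \<bullet> e = 0 \<and> y + t *\<^sub>R e \<in> K}"
    unfolding eq by (rule hausdorff_measure_translation[symmetric])
  also have "\<dots> = hausdorff_measure (DIM('a) - 1) (flat_cube e 0 1) * emeasure lborel (cylinder e {y. y \<bullet> e = 0 \<and> y + t *\<^sub>R e \<in> K})"
    using c by (intro hausdorff_measure_eq_cylinder e) auto
  finally show "hausdorff_measure (DIM('a) - 1) {x \<in> K. x \<bullet> e = t}
    = hausdorff_measure (DIM('a) - 1) (flat_cube e 0 1) * emeasure lborel (cylinder e {y. y \<bullet> e = 0 \<and> y + t *\<^sub>R e \<in> K})" .
qed

lemma emeasure_lborel_reflect: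
  fixes X :: "'a::euclidean_space set"
  assumes "X \<in> sets borel"
  shows "emeasure lborel ((\<lambda>x. a - x) -` X) = emeasure lborel X"
proof -
  have "distr lborel borel (\<lambda>x. a + (- 1) *\<^sub>R x) = (lborel :: 'a measure)"
    using lborel_affine[of "- 1" a] by (simp add: density_1)
  then have "emeasure lborel X = emeasure (distr lborel borel (\<lambda>x. a - x)) X" by simp
  also have "\<dots> = emeasure lborel ((\<lambda>x. a - x) -` X)" using assms by (subst emeasure_distr) auto
  finally show ?thesis by simp
qed

lemma ennreal_power2_le_imp_le:
  fixes a b :: ennreal
  assumes "a\<^sup>2 \<le> b\<^sup>2"
  shows "a \<le> b"
proof (cases "a = top \<or> b = top")
  case True
  then show ?thesis using assms by (auto simp: top_unique power2_eq_square ennreal_mult_eq_top_iff)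
next
  case False
  then obtain p q where pq: "a = ennreal p" "b = ennreal q" "0 \<le> p" "0 \<le> q"
    by (cases a; cases b) auto
  with assms have "p\<^sup>2 \<le> q\<^sup>2" by (simp add: ennreal_power ennreal_le_iff)
  with pq show ?thesis by (auto intro: ennreal_leI power2_le_imp_le)
qed

text \<open>By symmetry the slices at heights \<open>t\<close> and \<open>- t\<close> have cylinders
  of equal volume, so the product in Brunn-Minkowski is a square. Cylinders pass to midpoints as
  well, their heights ranging over the convex interval [0, 1].\<close>

lemma hausdorff_measure_central_slice_max:
  fixes K :: "'a::euclidean_space set"
  assumes K: "compact K" "convex K" and sym: "\<And>x. x \<in> K \<Longrightarrow> - x \<in> K" and e: "e \<in> Basis"
  shows "hausdorff_measure (DIM('a) - 1) {x \<in> K. x \<bullet> e = t} \<le> hausdorff_measure (DIM('a) - 1) {x \<in> K. x \<bullet> e = 0}"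
proof -
  define S where "S r = {y. y \<bullet> e = 0 \<and> y + r *\<^sub>R e \<in> K}" for r
  have ne: "norm e = 1" using e by simp
  have S_sub: "S r \<subseteq> {x. x \<bullet> e = 0}" for r by (auto simp: S_def)
  have cyl_S: "y \<in> cylinder e (S r) \<longleftrightarrow> y \<bullet> e \<in> {0..1} \<and> y - (y \<bullet> e) *\<^sub>R e + r *\<^sub>R e \<in> K" for y r
    unfolding in_cylinder_iff[OF ne S_sub] using e by (simp add: S_def inner_diff_left)
  have cS: "compact (cylinder e (S r))" for r
    unfolding S_def by (intro compact_cylinder hausdorff_measure_slice_translate(2) e K)
  have bor: "cylinder e (S r) \<in> sets borel" for r using cS by (rule borel_compact)
  \<comment> \<open>The reflection is x to e - x and not x to - x, because the height along
    \<open>e\<close> has to stay in [0, 1].\<close>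
  have neg: "cylinder e (S (- t)) = (\<lambda>x. e - x) -` cylinder e (S t)"
  proof -
    have iff: "- x \<in> K \<longleftrightarrow> x \<in> K" for x using sym[of x] sym[of "- x"] by auto
    have "y \<in> cylinder e (S (- t)) \<longleftrightarrow> e - y \<in> cylinder e (S t)" for y
    proof -
      have ey: "(e - y) \<bullet> e = 1 - y \<bullet> e" using e by (simp add: inner_diff_left)
      have "e - y - ((e - y) \<bullet> e) *\<^sub>R e + t *\<^sub>R e = - (y - (y \<bullet> e) *\<^sub>R e + (- t) *\<^sub>R e)"
        unfolding ey by (simp add: algebra_simps)
      moreover have "(e - y) \<bullet> e \<in> {0..1} \<longleftrightarrow> y \<bullet> e \<in> {0..1}" unfolding ey by auto
      ultimately show ?thesis
        by (simp only: cyl_S iff)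
    qed
    then show ?thesis by auto
  qed
  have "emeasure lborel (cylinder e (S t)) * emeasure lborel (cylinder e (S (- t))) \<le> (emeasure lborel (cylinder e (S 0)))\<^sup>2"
  proof (rule brunn_minkowski_lborel)
    fix x y assume xy: "x \<in> cylinder e (S t)" "y \<in> cylinder e (S (- t))"
    define p q where "p = x - (x \<bullet> e) *\<^sub>R e" and "q = y - (y \<bullet> e) *\<^sub>R e"
    have *: "x \<bullet> e \<in> {0..1}" "p + t *\<^sub>R e \<in> K" "y \<bullet> e \<in> {0..1}" "q + (- t) *\<^sub>R e \<in> K"
      using xy unfolding cyl_S p_def q_def by blast+
    \<comment> \<open>The opposite heights cancel in the average, which therefore lies in the
      central slice.\<close>
    have "(1/2) *\<^sub>R (p + t *\<^sub>R e) + (1/2) *\<^sub>R (q + (- t) *\<^sub>R e) \<in> K"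
      by (rule convexD[OF K(2)]) (use * in auto)
    also have "(1/2) *\<^sub>R (p + t *\<^sub>R e) + (1/2) *\<^sub>R (q + (- t) *\<^sub>R e) = midpoint x y - (midpoint x y \<bullet> e) *\<^sub>R e"
      by (simp add: p_def q_def midpoint_def algebra_simps inner_left_distrib)
    finally have "midpoint x y - (midpoint x y \<bullet> e) *\<^sub>R e + 0 *\<^sub>R e \<in> K" by simp
    moreover have "midpoint x y \<bullet> e = (x \<bullet> e + y \<bullet> e) / 2"
      by (simp add: midpoint_def inner_left_distrib)
    then have "midpoint x y \<bullet> e \<in> {0..1}" using * by simp
    ultimately show "midpoint x y \<in> cylinder e (S 0)"
      unfolding cyl_S by blast
  qed (use cS bor in \<open>auto simp: compact_imp_bounded\<close>)
  then have "(emeasure lborel (cylinder e (S t)))\<^sup>2 \<le> (emeasure lborel (cylinder e (S 0)))\<^sup>2"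
    using bor by (simp add: neg emeasure_lborel_reflect power2_eq_square)
  then have "emeasure lborel (cylinder e (S t)) \<le> emeasure lborel (cylinder e (S 0))"
    by (rule ennreal_power2_le_imp_le)
  then show ?thesis
    unfolding hausdorff_measure_slice_translate(1)[OF e K(1)] S_def by (rule mult_left_mono) simp
qed

text \<open>Meant for left translations in adapted coordinates. By \<open>tri\<close>, the
  \<open>b\<close>-component of the displacement P x - x is constant along basis directions of rank
  at least \<open>rk b\<close>. The direction \<open>e\<close> is exempt, since the height is fixed
  on a slice.\<close>

lemma hausdorff_measure_triangular_slice:
  fixes P :: "'a::euclidean_space \<Rightarrow> 'a" and rk :: "'a \<Rightarrow> nat"
  assumes e: "e \<in> Basis" and cont: "continuous_on UNIV P" and Pe: "\<And>x. P x \<bullet> e = x \<bullet> e - t"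
    and tri: "\<And>b c x s. b \<in> Basis - {e} \<Longrightarrow> c \<in> Basis - {e} \<Longrightarrow> rk b \<le> rk c
      \<Longrightarrow> (P (x + s *\<^sub>R c) - (x + s *\<^sub>R c)) \<bullet> b = (P x - x) \<bullet> b"
    and K: "compact K" and F: "compact F" "F \<subseteq> {y. y \<bullet> e = 0}"
    and iff: "\<And>x. x \<bullet> e = t \<Longrightarrow> P x \<in> F \<longleftrightarrow> x \<in> K"
  shows "hausdorff_measure (DIM('a) - 1) F = hausdorff_measure (DIM('a) - 1) {x \<in> K. x \<bullet> e = t}"
proof -
  define S where "S = {y. y \<bullet> e = 0 \<and> y + t *\<^sub>R e \<in> K}"
  \<comment> \<open>\<open>P\<close> acts on the slice at height \<open>t\<close>, the coordinate along \<open>e\<close> is kept: cylinders go to cylinders.\<close>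
  define \<Phi> where "\<Phi> x = P (x - (x \<bullet> e) *\<^sub>R e + t *\<^sub>R e) + (x \<bullet> e) *\<^sub>R e" for x
  define q where "q b x = (\<Phi> x - x) \<bullet> b" for b x
  have ne: "norm e = 1" using e by simp
  have cont\<Phi>: "continuous_on UNIV \<Phi>"
    unfolding \<Phi>_def by (intro continuous_intros continuous_on_compose2[OF cont]) auto
  have \<Phi>e: "\<Phi> x \<bullet> e = x \<bullet> e" for x
    using e by (simp add: \<Phi>_def inner_left_distrib inner_diff_left Pe)
  have q_meas: "q b \<in> borel_measurable borel" for b
    unfolding q_def by (intro borel_measurable_continuous_onI continuous_intros cont\<Phi>)
  have q_tri: "q b (x + s *\<^sub>R c) = q b x" if "b \<in> Basis - {e}" "c \<in> Basis - {e}" "rk b \<le> rk c" for b c x s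
  proof -
    have ce: "c \<bullet> e = 0" using that e by (auto simp: inner_Basis)
    let ?w = "x - (x \<bullet> e) *\<^sub>R e + t *\<^sub>R e"
    have "x + s *\<^sub>R c - ((x + s *\<^sub>R c) \<bullet> e) *\<^sub>R e + t *\<^sub>R e = ?w + s *\<^sub>R c"
      by (simp add: ce inner_left_distrib algebra_simps)
    then have "\<Phi> (x + s *\<^sub>R c) = P (?w + s *\<^sub>R c) + ((x + s *\<^sub>R c) \<bullet> e) *\<^sub>R e"
      by (simp only: \<Phi>_def)
    then have "\<Phi> (x + s *\<^sub>R c) = P (?w + s *\<^sub>R c) + (x \<bullet> e) *\<^sub>R e"
      by (simp add: ce inner_left_distrib)
    then show ?thesis
      using tri[OF that, of ?w s] by (simp add: q_def \<Phi>_def inner_left_distrib inner_diff_left)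
  qed
  have "\<Phi> x = x + (\<Sum>b\<in>Basis - {e}. q b x *\<^sub>R b)" for x
  proof -
    have "\<Phi> x - x = (\<Sum>b\<in>Basis. q b x *\<^sub>R b)" by (simp add: q_def euclidean_representation)
    also have "\<dots> = (\<Sum>b\<in>Basis - {e}. q b x *\<^sub>R b)"
      using e by (subst sum.remove[of _ e]) (auto simp: q_def inner_diff_left \<Phi>e)
    finally show ?thesis by (simp add: algebra_simps)
  qed
  then have "distr lborel borel \<Phi> = distr lborel borel (\<lambda>x. x + (\<Sum>b\<in>Basis - {e}. q b x *\<^sub>R b))"
    by presburger
  also have "\<dots> = lborel"
    by (rule lborel_distr_triangular[where rk = rk]) (use q_meas q_tri in auto)
  finally have inv: "distr lborel borel \<Phi> = lborel" .
  have cyl: "\<Phi> -` cylinder e F = cylinder e S"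
  proof -
    have S_sub: "S \<subseteq> {y. y \<bullet> e = 0}" by (auto simp: S_def)
    have "\<Phi> x \<in> cylinder e F \<longleftrightarrow> x \<in> cylinder e S" for x
    proof -
      let ?w = "x - (x \<bullet> e) *\<^sub>R e"
      have "\<Phi> x - (\<Phi> x \<bullet> e) *\<^sub>R e = P (?w + t *\<^sub>R e)" by (simp add: \<Phi>e) (simp add: \<Phi>_def)
      moreover have "?w \<bullet> e = 0" "(?w + t *\<^sub>R e) \<bullet> e = t" using e by (simp_all add: inner_diff_left inner_left_distrib)
      ultimately show ?thesis
        unfolding in_cylinder_iff[OF ne F(2)] in_cylinder_iff[OF ne S_sub]
        using iff[of "?w + t *\<^sub>R e"] by (simp add: \<Phi>e S_def)
    qed
    then show ?thesis by auto
  qed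
  have "emeasure lborel (cylinder e F) = emeasure (distr lborel borel \<Phi>) (cylinder e F)" by (simp add: inv)
  also have "\<dots> = emeasure lborel (\<Phi> -` cylinder e F)"
    using F(1) cont\<Phi> by (subst emeasure_distr)
      (auto intro!: borel_measurable_continuous_onI borel_compact compact_cylinder)
  finally have "emeasure lborel (cylinder e F) = emeasure lborel (cylinder e S)" by (simp add: cyl)
  then show ?thesis
    using hausdorff_measure_eq_cylinder[OF e F(2,1)] hausdorff_measure_slice_translate(1)[OF e K, of t]
    by (simp add: S_def)
qed

subsection \<open>Stratified groups\<close>

lemma nested_bracket_Cons: "xs \<noteq> [] \<Longrightarrow> nested_bracket br (x # xs) = br x (nested_bracket br xs)"
  by (cases xs) auto

text \<open>
  Dynkin's formula is split into its two terms of degree one, whose sum is \<open>x + y\<close>, and the terms of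
  degree at least two, indexed by \<open>bch_higher\<close>.
\<close>

definition bch_word :: "(nat \<times> nat) list \<Rightarrow> 'a \<Rightarrow> 'a \<Rightarrow> 'a list" where
  "bch_word ps x y = concat (map (\<lambda>(r, s). replicate r x @ replicate s y) ps)"

definition bch_coeff :: "(nat \<times> nat) list \<Rightarrow> real" where
  "bch_coeff ps = (-1) ^ (length ps - 1) /
    (real (length ps) * real (\<Sum>(r, s)\<leftarrow>ps. r + s) * (\<Prod>(r, s)\<leftarrow>ps. fact r * fact s))"

definition bch_higher :: "nat \<Rightarrow> (nat \<times> nat) list set" where
  "bch_higher \<iota> = {ps. ps \<noteq> [] \<and> (\<forall>(r, s) \<in> set ps. 0 < r + s) \<and>
    2 \<le> (\<Sum>(r, s)\<leftarrow>ps. r + s) \<and> (\<Sum>(r, s)\<leftarrow>ps. r + s) \<le> \<iota>}"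

lemma length_bch_word: "length (bch_word ps x y) = (\<Sum>(r, s)\<leftarrow>ps. r + s)"
  by (induction ps) (simp_all add: bch_word_def split_beta)

lemma set_bch_word: "set (bch_word ps x y) \<subseteq> {x, y}"
  by (induction ps) (auto simp: bch_word_def split_beta set_replicate_conv_if split: if_splits)

lemma list_all2_bch_word:
  assumes "R x x'" "R y y'"
  shows "list_all2 R (bch_word ps x y) (bch_word ps x' y')"
proof -
  have rep: "R a b \<Longrightarrow> list_all2 R (replicate n a) (replicate n b)" for a b n
    by (induction n) auto
  show ?thesis
    by (induction ps) (use assms in \<open>auto simp: bch_word_def intro!: list_all2_appendI rep\<close>)
qed

lemma length_le_sum_list:
  assumes "\<forall>(r, s) \<in> set ps. 0 < r + s"
  shows "length ps \<le> (\<Sum>(r, s)\<leftarrow>ps. r + s)"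
  using assms by (induction ps) auto

lemma finite_bch_higher: "finite (bch_higher \<iota>)"
proof (rule finite_subset)
  show "bch_higher \<iota> \<subseteq> {ps. set ps \<subseteq> {..\<iota>} \<times> {..\<iota>} \<and> length ps \<le> \<iota>}"
  proof
    fix ps assume ps: "ps \<in> bch_higher \<iota>"
    have "r + s \<le> (\<Sum>(r, s)\<leftarrow>ps. r + s)" if "(r, s) \<in> set ps" for r s
      using member_le_sum_list[of "r + s" "map (\<lambda>(r, s). r + s) ps"] that by force
    then have "set ps \<subseteq> {..\<iota>} \<times> {..\<iota>}"
      using ps by (fastforce simp: bch_higher_def)
    then show "ps \<in> {ps. set ps \<subseteq> {..\<iota>} \<times> {..\<iota>} \<and> length ps \<le> \<iota>}"
      using ps length_le_sum_list[of ps] by (auto simp: bch_higher_def)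
  qed
  show "finite {ps. set ps \<subseteq> {..\<iota>} \<times> {..\<iota>} \<and> length ps \<le> \<iota>}"
    by (rule finite_lists_length_le) simp
qed

text \<open>Every pair has positive degree, so a list of degree below 2 is a single pair (1, 0) or
  (0, 1); its coefficient is 1 and its word is \<open>x\<close> or \<open>y\<close>. The hypothesis
  keeps both inside the truncation.\<close>

lemma bch_eq:
  assumes "1 \<le> \<iota>"
  shows "bch \<iota> br x y = x + y + (\<Sum>ps\<in>bch_higher \<iota>. bch_coeff ps *\<^sub>R nested_bracket br (bch_word ps x y))"
proof -
  have split: "{ps. ps \<noteq> [] \<and> (\<forall>(r, s) \<in> set ps. 0 < r + s) \<and> (\<Sum>(r, s)\<leftarrow>ps. r + s) \<le> \<iota>}
      = {[(1, 0)], [(0, 1)]} \<union> bch_higher \<iota>" (is "?L = ?R")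
  proof
    show "?R \<subseteq> ?L" using assms by (auto simp: bch_higher_def)
    show "?L \<subseteq> ?R"
    proof
      fix ps assume ps: "ps \<in> ?L"
      show "ps \<in> ?R"
      proof (cases "2 \<le> (\<Sum>(r, s)\<leftarrow>ps. r + s)")
        case False
        have "length ps \<le> (\<Sum>(r, s)\<leftarrow>ps. r + s)" using ps by (intro length_le_sum_list) auto
        with False have "length ps \<le> 1" by linarith
        with ps obtain p where "ps = [p]" by (cases ps) auto
        then obtain r s where "ps = [(r, s)]" by (cases p) auto
        with ps False show ?thesis by (auto simp: less_Suc_eq numeral_2_eq_2)
      qed (use ps in \<open>auto simp: bch_higher_def\<close>)
    qed
  qed
  have disj: "{[(1, 0)], [(0, 1)]} \<inter> bch_higher \<iota> = {}" by (auto simp: bch_higher_def)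
  have "bch \<iota> br x y = (\<Sum>ps\<in>{[(1, 0)], [(0, 1)]} \<union> bch_higher \<iota>. bch_coeff ps *\<^sub>R nested_bracket br (bch_word ps x y))"
    unfolding bch_def split bch_coeff_def bch_word_def ..
  also have "\<dots> = (\<Sum>ps\<in>{[(1, 0)], [(0, 1)]}. bch_coeff ps *\<^sub>R nested_bracket br (bch_word ps x y))
      + (\<Sum>ps\<in>bch_higher \<iota>. bch_coeff ps *\<^sub>R nested_bracket br (bch_word ps x y))"
    using disj by (intro sum.union_disjoint finite_bch_higher) auto
  also have "(\<Sum>ps\<in>{[(1, 0)], [(0, 1)]}. bch_coeff ps *\<^sub>R nested_bracket br (bch_word ps x y)) = x + y"
    by (simp add: bch_coeff_def bch_word_def)
  finally show ?thesis .
qed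

lemma continuous_nested_bracket:
  fixes br :: "'a::euclidean_space \<Rightarrow> 'a \<Rightarrow> 'a"
  assumes "bilinear br" "\<And>f. f \<in> set fs \<Longrightarrow> continuous_on S f"
  shows "continuous_on S (\<lambda>x. nested_bracket br (map (\<lambda>f. f x) fs))"
  using assms(2)
proof (induction fs)
  case (Cons f fs)
  show ?case
  proof (cases "fs = []")
    case False
    have "continuous_on S (\<lambda>x. br (f x) (nested_bracket br (map (\<lambda>f. f x) fs)))"
      using assms(1) Cons
      by (intro bounded_bilinear.continuous_on[of br]) (auto simp: bilinear_conv_bounded_bilinear)
    then show ?thesis using False by (simp add: nested_bracket_Cons)
  qed (use Cons in auto)
qed simp

text \<open>The letters may be functions that are evaluated only at the end. This presents a word
  depending on \<open>x\<close> in the form required by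
  \<open>continuous_nested_bracket\<close>.\<close>

lemma bch_word_map: "bch_word ps (g x) (h x) = map (\<lambda>f. f x) (bch_word ps g h)"
  by (induction ps) (auto simp: bch_word_def)

lemma homogeneous_distanceD:
  assumes "homogeneous_distance V \<iota> br d"
  shows "Metric_space UNIV d" and "continuous_on UNIV (\<lambda>(x, y). d x y)"
    and "d (bch \<iota> br z x) (bch \<iota> br z y) = d x y"
    and "0 < r \<Longrightarrow> d (dilation V \<iota> r x) (dilation V \<iota> r y) = r * d x y"
  using assms by (simp_all add: homogeneous_distance_def)

section \<open>Left translations and the filtration by layers\<close>

context stratified_group
begin

lemma continuous_on_bch: "continuous_on UNIV (bch \<iota> br z)"
proof -
  have "continuous_on UNIV (\<lambda>x. nested_bracket br (bch_word ps z x))" for ps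
  proof -
    have "continuous_on UNIV (\<lambda>x. nested_bracket br (map (\<lambda>f. f x) (bch_word ps (\<lambda>_. z) (\<lambda>x. x))))"
      using set_bch_word[of ps "\<lambda>_. z" "\<lambda>x. x"] by (intro continuous_nested_bracket bilinear_br) auto
    then show ?thesis using bch_word_map[of ps "\<lambda>_. z" _ "\<lambda>x. x"] by simp
  qed
  then have "continuous_on UNIV (\<lambda>x. z + x + (\<Sum>ps\<in>bch_higher \<iota>. bch_coeff ps *\<^sub>R nested_bracket br (bch_word ps z x)))"
    by (intro continuous_intros)
  then show ?thesis by (rule continuous_on_eq) (simp only: bch_eq[OF last_layer(1)])
qed

lemma br_simps:
  "br (x + y) z = br x z + br y z" "br x (y + z) = br x y + br x z"
  "br (x - y) z = br x z - br y z" "br x (y - z) = br x y - br x z"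
  "br (c *\<^sub>R x) z = c *\<^sub>R br x z" "br x (c *\<^sub>R z) = c *\<^sub>R br x z"
  "br 0 z = 0" "br x 0 = 0" "br (- x) z = - br x z" "br x (- z) = - br x z"
  using bilinear_br
  by (simp_all add: bilinear_ladd bilinear_radd bilinear_lsub bilinear_rsub bilinear_lmul bilinear_rmul bilinear_lzero bilinear_rzero bilinear_lneg bilinear_rneg)

lemma br_commute: "br x y = - br y x"
proof -
  have "br (x + y) (x + y) = br x x + br x y + (br y x + br y y)" by (simp add: br_simps(1,2))
  then have "br x y + br y x = 0" by (simp add: alternating_br)
  then show ?thesis by (simp add: eq_neg_iff_add_eq_0)
qed

text \<open>Induction on the first layer: \<open>V (Suc i)\<close> is spanned by brackets [a, b]
  with a in \<open>V 1\<close> and b in \<open>V i\<close>, and the Jacobi identity gives [[a, b],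
  y] = [a, [b, y]] - [b, [a, y]].\<close>

lemma br_layers: "1 \<le> i \<Longrightarrow> 1 \<le> j \<Longrightarrow> x \<in> V i \<Longrightarrow> y \<in> V j \<Longrightarrow> br x y \<in> V (i + j)"
proof (induction i arbitrary: x y j rule: nat_induct_at_least)
  case base
  then have "br x y \<in> span {br x y | x y. x \<in> V 1 \<and> y \<in> V j}"
    by (intro span_base) blast
  then show ?case using layer_Suc[OF base(1)] by simp
next
  case (Suc i)
  have "x \<in> span {br x y | x y. x \<in> V 1 \<and> y \<in> V i}"
    using Suc layer_Suc by auto
  then show ?case
  proof (induction rule: span_induct_alt)
    case base
    then show ?case using subspace_layer[of "Suc i + j"] by (simp add: br_simps subspace_0)
  next
    case (step c u w)
    then obtain a b where u: "u = br a b" "a \<in> V 1" "b \<in> V i" by blast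
    have "br u y = br a (br b y) - br b (br a y)"
    proof -
      have "br a (br b y) - br b (br a y) - br (br a b) y = 0"
        using jacobi[of a b y] unfolding br_commute[of y "br a b"] br_commute[of y a]
        by (simp add: br_simps)
      then show ?thesis using u by simp
    qed
    moreover have "br a (br b y) \<in> V (Suc (i + j))"
    proof -
      have "br b y \<in> V (i + j)" using Suc u by blast
      then have "br a (br b y) \<in> span {br x y | x y. x \<in> V 1 \<and> y \<in> V (i + j)}"
        using u by (intro span_base) blast
      then show ?thesis using layer_Suc[of "i + j"] Suc by simp
    qed
    moreover have "br b (br a y) \<in> V (Suc (i + j))"
    proof -
      have "br a y \<in> span {br x y | x y. x \<in> V 1 \<and> y \<in> V j}"
        using u Suc by (intro span_base) blast
      then have "br a y \<in> V (Suc j)" using layer_Suc[of j] Suc by simp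
      \<comment> \<open>Here the induction hypothesis is applied with second layer
        \<open>Suc j\<close>, which is why \<open>j\<close> and \<open>y\<close> are
        generalized.\<close>
      then have "br b (br a y) \<in> V (i + Suc j)" using u Suc by (intro Suc.IH) auto
      then show ?thesis by simp
    qed
    ultimately have "br u y \<in> V (Suc i + j)"
      using subspace_layer[of "Suc (i + j)"] by (simp add: subspace_diff)
    then show ?case
      using step subspace_layer[of "Suc i + j"] by (simp add: br_simps subspace_add subspace_scale)
  qed
qed

text \<open>The descending filtration by the sums of the layers from \<open>j\<close> on. It is
  everything at 1 and {0} beyond \<iota>.\<close>

definition tail :: "nat \<Rightarrow> 'a set" where
  "tail j = span (\<Union>i\<in>{j..\<iota>}. V i)"

lemma subspace_tail [simp]: "subspace (tail j)"
  by (simp add: tail_def)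

lemma layer_subset_tail:
  assumes "1 \<le> j" "j \<le> i" shows "V i \<subseteq> tail j"
proof (cases "i \<le> \<iota>")
  case True
  then have "V i \<subseteq> (\<Union>i\<in>{j..\<iota>}. V i)" using assms by auto
  then show ?thesis unfolding tail_def using span_superset by blast
next
  case False
  then show ?thesis using layer_beyond[of i] subspace_0[OF subspace_tail] by auto
qed

lemma tail_mono: "i \<le> j \<Longrightarrow> tail j \<subseteq> tail i"
  unfolding tail_def by (intro span_mono UN_mono) auto

lemma tail_1: "tail 1 = UNIV"
proof -
  have "x \<in> tail 1" for x
  proof -
    obtain c where c: "\<forall>j. if j \<in> {1..\<iota>} then c j \<in> V j else c j = 0" "x = (\<Sum>j=1..\<iota>. c j)"
      using direct_sum[of x] by blast
    have "c j \<in> tail 1" if "j \<in> {1..\<iota>}" for j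
      using c(1)[rule_format, of j] layer_subset_tail[of 1 j] that by auto
    then show ?thesis unfolding c(2) by (intro subspace_sum) auto
  qed
  then show ?thesis by auto
qed

lemma br_tail:
  assumes j: "1 \<le> j" and y: "y \<in> tail j"
  shows "br x y \<in> tail (Suc j)" "br y x \<in> tail (Suc j)"
proof -
  have gen: "br a b \<in> tail (Suc j)" if "a \<in> V i" "1 \<le> i" "b \<in> V k" "j \<le> k" for a b i k
    using br_layers[of i k a b] layer_subset_tail[of "Suc j" "i + k"] that j by auto
  have step: "br a y \<in> tail (Suc j)" if "a \<in> V i" "1 \<le> i" for a i
    using y unfolding tail_def[of j]
  proof (induction rule: span_induct_alt)
    case (step c b w)
    then show ?case using gen[OF that] by (auto simp: br_simps intro!: subspace_add subspace_scale)
  qed (simp add: br_simps subspace_0)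
  have "x \<in> span (\<Union>i\<in>{1..\<iota>}. V i)" using tail_1 by (auto simp: tail_def)
  then show *: "br x y \<in> tail (Suc j)"
  proof (induction rule: span_induct_alt)
    case (step c b w)
    then show ?case using \<open>\<And>i a. a \<in> V i \<Longrightarrow> 1 \<le> i \<Longrightarrow> br a y \<in> tail (Suc j)\<close>
      by (auto simp: br_simps intro!: subspace_add subspace_scale)
  qed (simp add: br_simps subspace_0)
  then show "br y x \<in> tail (Suc j)"
    using br_commute[of y x] by (simp add: subspace_neg)
qed

text \<open>Telescoping: [x, N] - [y, M] = [x - y, N] + [y, N - M], and each bracket with an element
  of \<open>tail j\<close> lands in \<open>tail (Suc j)\<close>. The first claim feeds the term N -
  M in the induction, where the remaining word may have a single letter.\<close>

lemma nested_bracket_tail_diff: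
  assumes j: "1 \<le> j" and all: "list_all2 (\<lambda>a b. a - b \<in> tail j) xs ys"
  shows "xs \<noteq> [] \<Longrightarrow> nested_bracket br xs - nested_bracket br ys \<in> tail j"
    and "2 \<le> length xs \<Longrightarrow> nested_bracket br xs - nested_bracket br ys \<in> tail (Suc j)"
proof -
  have "(xs \<noteq> [] \<longrightarrow> nested_bracket br xs - nested_bracket br ys \<in> tail j) \<and>
      (2 \<le> length xs \<longrightarrow> nested_bracket br xs - nested_bracket br ys \<in> tail (Suc j))"
    using all
  proof (induction rule: list_all2_induct)
    case (Cons x xs y ys)
    show ?case
    proof (cases "xs = []")
      case True
      then show ?thesis using Cons by simp
    next
      case False
      then have "ys \<noteq> []" using Cons(2) by auto
      let ?N = "nested_bracket br xs" and ?M = "nested_bracket br ys"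
      have "br x ?N - br y ?M = br (x - y) ?N + br y (?N - ?M)" by (simp add: br_simps)
      moreover have "br (x - y) ?N \<in> tail (Suc j)" using Cons(1) j by (intro br_tail)
      moreover have "br y (?N - ?M) \<in> tail (Suc j)" using Cons(3) False j by (intro br_tail) auto
      ultimately have "br x ?N - br y ?M \<in> tail (Suc j)" by (simp add: subspace_add)
      then show ?thesis using False \<open>ys \<noteq> []\<close> tail_mono[of j "Suc j"] by (auto simp: nested_bracket_Cons)
    qed
  qed simp
  then show "xs \<noteq> [] \<Longrightarrow> nested_bracket br xs - nested_bracket br ys \<in> tail j"
    and "2 \<le> length xs \<Longrightarrow> nested_bracket br xs - nested_bracket br ys \<in> tail (Suc j)" by auto
qed

lemma nested_bracket_tail_2:
  assumes "2 \<le> length xs"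
  shows "nested_bracket br xs \<in> tail 2"
proof -
  obtain x ys where "xs = x # ys" "ys \<noteq> []" using assms by (cases xs) (auto simp: Suc_le_eq)
  then show ?thesis
    using br_tail(1)[of 1 "nested_bracket br ys" x] tail_1 by (simp add: nested_bracket_Cons numeral_2_eq_2)
qed

lemma nested_bracket_multiples:
  assumes "set xs \<subseteq> range (\<lambda>c. c *\<^sub>R x)"
  shows "2 \<le> length xs \<Longrightarrow> nested_bracket br xs = 0"
proof -
  have "nested_bracket br xs \<in> range (\<lambda>c. c *\<^sub>R x) \<and> (2 \<le> length xs \<longrightarrow> nested_bracket br xs = 0)"
    using assms
  proof (induction xs)
    case Nil
    have "0 = 0 *\<^sub>R x" by simp
    then show ?case by auto
  next
    case (Cons a xs)
    show ?case
    proof (cases "xs = []")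
      case False
      obtain c where "a = c *\<^sub>R x" using Cons by auto
      moreover obtain c' where "nested_bracket br xs = c' *\<^sub>R x" using Cons by auto
      ultimately have "nested_bracket br (a # xs) = 0"
        using False by (simp add: nested_bracket_Cons br_simps alternating_br)
      moreover have "0 = 0 *\<^sub>R x" by simp
      ultimately show ?thesis by (metis rangeI)
    qed (use Cons in auto)
  qed
  then show "2 \<le> length xs \<Longrightarrow> nested_bracket br xs = 0" by blast
qed

text \<open>This is the triangularity of left translations with unit diagonal: the terms of degree
  one cancel against \<open>x - x'\<close>, and every other word has at least two letters, so its
  variation gains a layer.\<close>

lemma bch_tail_diff:
  assumes "1 \<le> j" "x - x' \<in> tail j"
  shows "bch \<iota> br z x - bch \<iota> br z x' - (x - x') \<in> tail (Suc j)"
proof -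
  have "bch \<iota> br z x - bch \<iota> br z x' - (x - x') =
      (\<Sum>ps\<in>bch_higher \<iota>. bch_coeff ps *\<^sub>R (nested_bracket br (bch_word ps z x) - nested_bracket br (bch_word ps z x')))"
    using last_layer(1) by (simp add: bch_eq sum_subtractf scaleR_diff_right)
  moreover have "nested_bracket br (bch_word ps z x) - nested_bracket br (bch_word ps z x') \<in> tail (Suc j)"
    if "ps \<in> bch_higher \<iota>" for ps
    using that assms
    by (intro nested_bracket_tail_diff list_all2_bch_word)
      (auto simp: length_bch_word bch_higher_def subspace_0)
  ultimately show ?thesis by (auto intro!: subspace_sum subspace_scale)
qed

lemma bch_tail_2: "bch \<iota> br x y - (x + y) \<in> tail 2"
proof -
  have "bch \<iota> br x y - (x + y) = (\<Sum>ps\<in>bch_higher \<iota>. bch_coeff ps *\<^sub>R nested_bracket br (bch_word ps x y))"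
    using last_layer(1) by (simp add: bch_eq)
  also have "\<dots> \<in> tail 2"
    by (intro subspace_sum subspace_scale nested_bracket_tail_2) (auto simp: length_bch_word bch_higher_def)
  finally show ?thesis .
qed

text \<open>All brackets of multiples of one vector vanish. The cases used are \<open>b = 0\<close>,
  showing that 0 is a right unit, and \<open>a = 1\<close>, \<open>b = - 1\<close>, showing that
  \<open>- x\<close> is the inverse of \<open>x\<close>.\<close>

lemma bch_multiples: "bch \<iota> br (a *\<^sub>R x) (b *\<^sub>R x) = (a + b) *\<^sub>R x"
proof -
  have "nested_bracket br (bch_word ps (a *\<^sub>R x) (b *\<^sub>R x)) = 0" if "ps \<in> bch_higher \<iota>" for ps
  proof (rule nested_bracket_multiples)
    show "set (bch_word ps (a *\<^sub>R x) (b *\<^sub>R x)) \<subseteq> range (\<lambda>c. c *\<^sub>R x)"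
      using set_bch_word[of ps "a *\<^sub>R x" "b *\<^sub>R x"] by auto
  qed (use that in \<open>auto simp: length_bch_word bch_higher_def\<close>)
  then show ?thesis using last_layer(1) by (simp add: bch_eq scaleR_left_distrib)
qed

section \<open>Orthonormal coordinates adapted to the layers\<close>

lemma layer_Int:
  assumes "i \<in> {1..\<iota>}" "j \<in> {1..\<iota>}" "i \<noteq> j" "x \<in> V i" "x \<in> V j"
  shows "x = 0"
proof -
  define c where "c k l = (if l = k then x else 0)" for k l :: nat
  have dec: "(\<forall>l. if l \<in> {1..\<iota>} then c k l \<in> V l else c k l = 0) \<and> x = (\<Sum>l=1..\<iota>. c k l)"
    if "k \<in> {1..\<iota>}" "x \<in> V k" for k
    using that subspace_layer by (auto simp: c_def subspace_0)
  have "c i = c j" using direct_sum[of x] dec[OF assms(1,4)] dec[OF assms(2,5)] by blast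
  then have "c i i = c j i" by simp
  then show ?thesis using assms(3) by (simp add: c_def)
qed

text \<open>Basis vectors of different blocks are distinct: a common one would lie in two layers and
  vanish, contradicting its norm 1. Hence they are orthogonal, and so are the spans.\<close>

lemma layers_orthogonal:
  assumes B: "adapted_orthonormal_basis V \<iota> B" and ij: "i \<in> {1..\<iota>}" "j \<in> {1..\<iota>}" "i \<noteq> j"
    and x: "x \<in> V i" and y: "y \<in> V j"
  shows "x \<bullet> y = 0"
proof -
  have ortho: "b \<bullet> b' = 0" if "b \<in> B i" "b' \<in> B j" for b b'
  proof -
    have "b \<bullet> b' = (if b = b' then 1 else 0)" "b \<bullet> b = 1"
      using B that ij unfolding adapted_orthonormal_basis_def by auto
    moreover have "b \<noteq> b'"
    proof
      assume "b = b'"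
      moreover have "b \<in> V i" "b' \<in> V j"
        using B that ij unfolding adapted_orthonormal_basis_def by (metis span_base)+
      ultimately have "b = 0" using layer_Int[OF ij] by simp
      with \<open>b \<bullet> b = 1\<close> show False by simp
    qed
    ultimately show ?thesis by simp
  qed
  have "x \<in> span (B i)" "y \<in> span (B j)" using B ij x y unfolding adapted_orthonormal_basis_def by auto
  then have "orthogonal x y"
    using ortho by (metis orthogonal_commute orthogonal_def orthogonal_to_span)
  then show ?thesis by (simp add: orthogonal_def)
qed

text \<open>The prescribed unit vector \<open>e\<close> is completed inside \<open>V 1\<close> by an
  orthonormal basis of its complement there; the other layers get arbitrary orthonormal bases, and
  \<open>orth\<close> makes the union orthonormal.\<close>

lemma layers_orthonormal_basis:
  assumes orth: "\<forall>i\<in>{1..\<iota>}. \<forall>j\<in>{1..\<iota>}. i \<noteq> j \<longrightarrow> (\<forall>x\<in>V i. \<forall>y\<in>V j. x \<bullet> y = 0)"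
    and e: "e \<in> V 1" "norm e = 1"
  obtains U where "e \<in> U 1" "\<And>j. j \<in> {1..\<iota>} \<Longrightarrow> U j \<subseteq> V j" "span (\<Union>j\<in>{1..\<iota>}. U j) = UNIV"
    "\<And>b b'. b \<in> (\<Union>j\<in>{1..\<iota>}. U j) \<Longrightarrow> b' \<in> (\<Union>j\<in>{1..\<iota>}. U j) \<Longrightarrow> b \<bullet> b' = (if b = b' then 1 else 0)"
proof -
  have ee: "e \<bullet> e = 1" using e by (simp add: norm_eq_1)
  have "subspace (V 1 \<inter> {x. e \<bullet> x = 0})"
    by (intro subspace_inter subspace_layer subspace_hyperplane) simp
  then obtain C where C: "C \<subseteq> V 1 \<inter> {x. e \<bullet> x = 0}" "pairwise orthogonal C" "\<And>x. x \<in> C \<Longrightarrow> norm x = 1"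
    "span C = V 1 \<inter> {x. e \<bullet> x = 0}"
    by (metis orthonormal_basis_subspace)
  have "\<exists>A. A \<subseteq> V j \<and> pairwise orthogonal A \<and> (\<forall>x\<in>A. norm x = 1) \<and> span A = V j" if "1 \<le> j" for j
    using orthonormal_basis_subspace[OF subspace_layer[OF that]] by metis
  then obtain A where A: "\<And>j. 1 \<le> j \<Longrightarrow> A j \<subseteq> V j \<and> pairwise orthogonal (A j) \<and> (\<forall>x\<in>A j. norm x = 1) \<and> span (A j) = V j"
    by metis
  define U where "U j = (if j = 1 then insert e C else A j)" for j
  have sub: "U j \<subseteq> V j" if "j \<in> {1..\<iota>}" for j
    using that e C A[of j] by (auto simp: U_def)
  have V1: "V 1 \<subseteq> span (insert e C)"
  proof
    fix x assume x: "x \<in> V 1"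
    have "x - (e \<bullet> x) *\<^sub>R e \<in> span C"
      unfolding C(4) using x e ee subspace_layer[of 1] by (auto simp: inner_diff_right subspace_diff subspace_scale)
    then show "x \<in> span (insert e C)" by (auto simp: span_breakdown_eq)
  qed
  have span_sub: "V j \<subseteq> span (\<Union>j\<in>{1..\<iota>}. U j)" if j: "j \<in> {1..\<iota>}" for j
  proof -
    have "V j \<subseteq> span (U j)" using j V1 A[of j] by (auto simp: U_def)
    also have "\<dots> \<subseteq> span (\<Union>j\<in>{1..\<iota>}. U j)" using j by (intro span_mono) auto
    finally show ?thesis .
  qed
  have "(\<Union>j\<in>{1..\<iota>}. V j) \<subseteq> span (\<Union>j\<in>{1..\<iota>}. U j)" using span_sub by blast
  then have "span (\<Union>j\<in>{1..\<iota>}. V j) \<subseteq> span (\<Union>j\<in>{1..\<iota>}. U j)"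
    by (intro span_minimal) auto
  then have span: "span (\<Union>j\<in>{1..\<iota>}. U j) = UNIV" using tail_1 by (auto simp: tail_def)
  have on: "b \<bullet> b' = (if b = b' then 1 else 0)"
    if bb': "b \<in> (\<Union>j\<in>{1..\<iota>}. U j)" "b' \<in> (\<Union>j\<in>{1..\<iota>}. U j)" for b b'
  proof -
    obtain i j where ij: "i \<in> {1..\<iota>}" "j \<in> {1..\<iota>}" "b \<in> U i" "b' \<in> U j" using bb' by auto
    have norm1: "b \<bullet> b = 1"
      using ij A[of i] C(3) e by (auto simp: U_def norm_eq_1 split: if_splits)
    show ?thesis
    proof (cases "b = b'")
      case False
      have "b \<bullet> b' = 0"
      proof (cases "i = j")
        case True
        then show ?thesis
          using ij False A[of i] C by (auto simp: U_def pairwise_def orthogonal_def inner_commute split: if_splits)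
      next
        case False
        then show ?thesis using orth sub ij by blast
      qed
      with False show ?thesis by simp
    qed (use norm1 in simp)
  qed
  have "e \<in> U 1" by (simp add: U_def)
  then show ?thesis by (rule that[OF _ sub span on])
qed

text \<open>The adapted orthonormal basis is matched with \<open>Basis\<close> by counting. The
  resulting isometry \<open>f\<close>, with inverse \<open>g\<close>, transports results on
  coordinate directions to the group; \<open>rk\<close> records the layer of each direction.\<close>

lemma layers_coordinates:
  assumes orth: "\<forall>i\<in>{1..\<iota>}. \<forall>j\<in>{1..\<iota>}. i \<noteq> j \<longrightarrow> (\<forall>x\<in>V i. \<forall>y\<in>V j. x \<bullet> y = 0)"
    and e: "e \<in> V 1" "norm e = 1"
  obtains f g :: "'a \<Rightarrow> 'a" and rk :: "'a \<Rightarrow> nat" where "linear f" "linear g" "\<And>x. f (g x) = x" "\<And>x. g (f x) = x"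
    "\<And>x y. f x \<bullet> f y = x \<bullet> y" "f e \<in> Basis"
    "\<And>b. b \<in> Basis \<Longrightarrow> rk b \<in> {1..\<iota>}" "\<And>b. b \<in> Basis \<Longrightarrow> g b \<in> V (rk b)"
proof -
  obtain U where U: "e \<in> U 1" "\<And>j. j \<in> {1..\<iota>} \<Longrightarrow> U j \<subseteq> V j" "span (\<Union>j\<in>{1..\<iota>}. U j) = UNIV"
    "\<And>b b'. b \<in> (\<Union>j\<in>{1..\<iota>}. U j) \<Longrightarrow> b' \<in> (\<Union>j\<in>{1..\<iota>}. U j) \<Longrightarrow> b \<bullet> b' = (if b = b' then 1 else 0)"
    by (rule layers_orthonormal_basis[OF orth e]) (rule that; assumption)
  define W where "W = (\<Union>j\<in>{1..\<iota>}. U j)"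
  have W_orth: "pairwise orthogonal W" and W_norm: "\<And>b. b \<in> W \<Longrightarrow> norm b = 1"
    using U(4) by (auto simp: W_def pairwise_def orthogonal_def norm_eq_1)
  have ind: "independent W"
    using pairwise_orthogonal_independent[OF W_orth] W_norm by force
  then have fin: "finite W" by (rule independent_imp_finite)
  have "card W = DIM('a)"
    using basis_card_eq_dim[of W UNIV] ind U(3) by (simp add: W_def)
  then obtain \<phi> where \<phi>: "bij_betw \<phi> (Basis :: 'a set) W"
    using fin finite_same_card_bij[of "Basis :: 'a set" W] by auto
  have \<phi>W: "\<phi> b \<in> W" if "b \<in> Basis" for b using \<phi> that by (auto simp: bij_betw_def)
  have \<phi>_inner: "\<phi> b \<bullet> \<phi> c = (if b = c then 1 else 0)" if "b \<in> Basis" "c \<in> Basis" for b c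
  proof -
    have "\<phi> b \<bullet> \<phi> c = (if \<phi> b = \<phi> c then 1 else 0)"
      using U(4) \<phi>W[OF that(1)] \<phi>W[OF that(2)] unfolding W_def by blast
    moreover have "\<phi> b = \<phi> c \<longleftrightarrow> b = c" using \<phi> that by (metis bij_betw_def inj_on_eq_iff)
    ultimately show ?thesis by simp
  qed
  define f where "f x = (\<Sum>b\<in>Basis. (x \<bullet> \<phi> b) *\<^sub>R b)" for x
  define g where "g y = (\<Sum>b\<in>Basis. (y \<bullet> b) *\<^sub>R \<phi> b)" for y
  have gf: "g (f x) = x" for x
  proof -
    have "g (f x) = (\<Sum>b\<in>Basis. (x \<bullet> \<phi> b) *\<^sub>R \<phi> b)"
      by (simp add: g_def f_def inner_sum_left inner_Basis if_distrib[of "\<lambda>x. _ * x"] cong: if_cong)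
    also have "\<dots> = (\<Sum>w\<in>W. (w \<bullet> x) *\<^sub>R w)"
      using sum.reindex_bij_betw[OF \<phi>, of "\<lambda>w. (w \<bullet> x) *\<^sub>R w"] by (simp add: inner_commute)
    also have "\<dots> = x"
      using orthonormal_basis_expand[OF W_orth W_norm _ fin, of x] U(3) by (simp add: W_def inner_commute)
    finally show ?thesis .
  qed
  have fg: "f (g y) = y" for y
  proof (rule euclidean_eqI)
    fix b :: 'a assume b: "b \<in> Basis"
    have "g y \<bullet> \<phi> b = (\<Sum>c\<in>Basis. (y \<bullet> c) * (\<phi> c \<bullet> \<phi> b))" by (simp add: g_def inner_sum_left)
    also have "\<dots> = (\<Sum>c\<in>Basis. if c = b then y \<bullet> c else 0)"
      using b \<phi>_inner by (intro sum.cong) auto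
    also have "\<dots> = y \<bullet> b" using b by simp
    finally show "f (g y) \<bullet> b = y \<bullet> b"
      using b by (simp add: f_def inner_sum_left inner_Basis if_distrib[of "\<lambda>x. _ * x"] cong: if_cong)
  qed
  have lin: "linear f" "linear g"
    unfolding f_def[abs_def] g_def[abs_def]
    by (auto intro!: linearI simp: inner_left_distrib scaleR_left_distrib sum.distrib scaleR_sum_right)
  have iso: "f x \<bullet> f y = x \<bullet> y" for x y
  proof -
    have "f x \<bullet> f y = (\<Sum>b\<in>Basis. (f x \<bullet> b) * (f y \<bullet> b))" by (rule euclidean_inner)
    also have "\<dots> = (\<Sum>b\<in>Basis. (x \<bullet> \<phi> b) * (y \<bullet> \<phi> b))"
      by (simp add: f_def inner_sum_left inner_Basis if_distrib[of "\<lambda>x. _ * x"] cong: if_cong)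
    also have "\<dots> = x \<bullet> (\<Sum>b\<in>Basis. (y \<bullet> \<phi> b) *\<^sub>R \<phi> b)"
      by (simp add: inner_sum_right mult.commute)
    also have "(\<Sum>b\<in>Basis. (y \<bullet> \<phi> b) *\<^sub>R \<phi> b) = g (f y)"
      by (simp add: g_def f_def inner_sum_left inner_Basis if_distrib[of "\<lambda>x. _ * x"] cong: if_cong)
    finally show ?thesis by (simp add: gf)
  qed
  have g_Basis: "g b = \<phi> b" if "b \<in> Basis" for b
    using that by (simp add: g_def inner_Basis if_distrib[of "\<lambda>x. x *\<^sub>R _"] cong: if_cong)
  have "e \<in> W" using U(1) last_layer(1) by (auto simp: W_def intro!: bexI[of _ 1])
  then obtain b0 where "b0 \<in> Basis" "e = \<phi> b0" using \<phi> by (auto simp: bij_betw_def)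
  then have fe: "f e \<in> Basis" using fg[of b0] g_Basis[of b0] by simp
  have "\<exists>j\<in>{1..\<iota>}. g b \<in> V j" if b: "b \<in> Basis" for b
  proof -
    obtain j where "j \<in> {1..\<iota>}" "\<phi> b \<in> U j" using \<phi>W[OF b] unfolding W_def by blast
    then show ?thesis using U(2)[of j] g_Basis[OF b] by (metis subsetD)
  qed
  then obtain rk where "\<And>b. b \<in> Basis \<Longrightarrow> rk b \<in> {1..\<iota>} \<and> g b \<in> V (rk b)" by metis
  then show ?thesis by (intro that[OF lin fg gf iso fe, of rk]) blast+
qed

text \<open>The definite description in \<open>dilation\<close> is resolved by uniqueness: the
  layers span the space, so a linear map is determined on them.\<close>

lemma dilation_eq:
  assumes "linear h" "\<And>j v. j \<in> {1..\<iota>} \<Longrightarrow> v \<in> V j \<Longrightarrow> h v = r ^ j *\<^sub>R v"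
  shows "dilation V \<iota> r = h"
  unfolding dilation_def
proof (rule the_equality)
  show "linear h \<and> (\<forall>j\<in>{1..\<iota>}. \<forall>v\<in>V j. h v = r ^ j *\<^sub>R v)" using assms by blast
  fix k assume k: "linear k \<and> (\<forall>j\<in>{1..\<iota>}. \<forall>v\<in>V j. k v = r ^ j *\<^sub>R v)"
  have "k x = h x" for x
    by (rule linear_eq_on_span[where B = "\<Union>j\<in>{1..\<iota>}. V j"]) (use k assms tail_1 in \<open>auto simp: tail_def\<close>)
  then show "k = h" by auto
qed

lemma inner_tail:
  assumes orth: "\<forall>i\<in>{1..\<iota>}. \<forall>j\<in>{1..\<iota>}. i \<noteq> j \<longrightarrow> (\<forall>x\<in>V i. \<forall>y\<in>V j. x \<bullet> y = 0)"
    and i: "i \<in> {1..\<iota>}" "i < j" and x: "x \<in> V i" and y: "y \<in> tail j"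
  shows "y \<bullet> x = 0"
  using y unfolding tail_def
proof (induction rule: span_induct_alt)
  case (step c b w)
  then obtain k where k: "k \<in> {j..\<iota>}" "b \<in> V k" by blast
  then have "k \<in> {1..\<iota>}" "i \<noteq> k" using i by auto
  then have "x \<bullet> b = 0" using orth[rule_format, OF i(1) _ _ x k(2)] by blast
  with step show ?case by (simp add: inner_left_distrib inner_commute[of b x])
qed simp

lemma vertical_subgroup_eq:
  assumes orth: "\<forall>i\<in>{1..\<iota>}. \<forall>j\<in>{1..\<iota>}. i \<noteq> j \<longrightarrow> (\<forall>x\<in>V i. \<forall>y\<in>V j. x \<bullet> y = 0)"
    and \<nu>: "\<nu> \<in> V 1"
  shows "vertical_subgroup V \<iota> \<nu> = {x. x \<bullet> \<nu> = 0}"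
proof
  have 1: "1 \<in> {1..\<iota>}" using last_layer(1) by simp
  have perp: "w \<bullet> \<nu> = 0" if "w \<in> tail 2" for w
    using inner_tail[OF orth 1 _ \<nu> that] by simp
  show "vertical_subgroup V \<iota> \<nu> \<subseteq> {x. x \<bullet> \<nu> = 0}"
    using perp by (auto simp: vertical_subgroup_def tail_def inner_left_distrib)
  show "{x. x \<bullet> \<nu> = 0} \<subseteq> vertical_subgroup V \<iota> \<nu>"
  proof
    fix x assume x: "x \<in> {x. x \<bullet> \<nu> = 0}"
    obtain c where c: "\<forall>j. if j \<in> {1..\<iota>} then c j \<in> V j else c j = 0" "x = (\<Sum>j=1..\<iota>. c j)"
      using direct_sum[of x] by blast
    define w where "w = (\<Sum>j=2..\<iota>. c j)"
    have xw: "x = c 1 + w"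
      using c(2) last_layer(1) by (simp add: w_def sum.atLeast_Suc_atMost numeral_2_eq_2)
    have w: "w \<in> tail 2"
      unfolding w_def
    proof (rule subspace_sum)
      fix j assume "j \<in> {2..\<iota>}"
      then show "c j \<in> tail 2" using c(1)[rule_format, of j] layer_subset_tail[of 2 j] by auto
    qed simp
    moreover have "c 1 \<in> V 1" using c(1)[rule_format, of 1] 1 by simp
    moreover have "c 1 \<bullet> \<nu> = 0" using x xw perp[OF w] by (simp add: inner_left_distrib)
    ultimately show "x \<in> vertical_subgroup V \<iota> \<nu>"
      unfolding vertical_subgroup_def using xw by (auto simp: tail_def)
  qed
qed

text \<open>The distance from 0 has a positive minimum m on the Euclidean unit sphere. A point x of
  the ball with norm above 1 is dilated onto the sphere by some r in (0, 1], so m \<le> r R, and its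
  norm is at most r^(-\<iota>) \<le> (R / m)^\<iota>.\<close>

lemma homogeneous_ball_compact:
  assumes orth: "\<forall>i\<in>{1..\<iota>}. \<forall>j\<in>{1..\<iota>}. i \<noteq> j \<longrightarrow> (\<forall>x\<in>V i. \<forall>y\<in>V j. x \<bullet> y = 0)"
    and e: "e \<in> V 1" "norm e = 1" and d: "homogeneous_distance V \<iota> br d" and R: "0 < R"
  shows "compact {x. d 0 x \<le> R}"
proof -
  obtain f g :: "'a \<Rightarrow> 'a" and rk :: "'a \<Rightarrow> nat" where fg: "linear f" "linear g" "\<And>x. f (g x) = x" "\<And>x. g (f x) = x"
    "\<And>x y. f x \<bullet> f y = x \<bullet> y" "f e \<in> Basis"
    and rk: "\<And>b. b \<in> Basis \<Longrightarrow> rk b \<in> {1..\<iota>}" "\<And>b. b \<in> Basis \<Longrightarrow> g b \<in> V (rk b)"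
    by (rule layers_coordinates[OF orth e]) (rule that; assumption)
  have norm_f: "norm (f x) = norm x" for x by (simp add: norm_eq_sqrt_inner fg)
  have norm_g: "norm (g x) = norm x" for x using norm_f[of "g x"] by (simp add: fg)
  \<comment> \<open>The dilation in coordinates, written as an explicit polynomial in
    \<open>r\<close>. It is continuous down to \<open>r = 0\<close>, where it vanishes because all
    ranks are at least 1.\<close>
  define D where "D r x = (\<Sum>b\<in>Basis. (r ^ rk b * (x \<bullet> b)) *\<^sub>R b)" for r :: real and x :: 'a
  have D_inner: "D r x \<bullet> b = r ^ rk b * (x \<bullet> b)" if "b \<in> Basis" for r x b
    using that by (simp add: D_def inner_sum_left inner_Basis if_distrib[of "\<lambda>x. _ * x"] cong: if_cong)
  have D_lin: "linear (D r)" for r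
    unfolding D_def[abs_def]
    by (auto intro!: linearI simp: inner_left_distrib scaleR_left_distrib sum.distrib scaleR_sum_right distrib_left mult.left_commute)
  have dil: "dilation V \<iota> r = (\<lambda>x. g (D r (f x)))" for r
  proof (rule dilation_eq)
    show "linear (\<lambda>x. g (D r (f x)))"
      using linear_compose[OF linear_compose[OF fg(1) D_lin[of r]] fg(2)] by (simp add: o_def)
    fix j v assume j: "j \<in> {1..\<iota>}" and v: "v \<in> V j"
    have "D r (f v) = r ^ j *\<^sub>R f v"
    proof (rule euclidean_eqI)
      fix b :: 'a assume b: "b \<in> Basis"
      have "f v \<bullet> b = v \<bullet> g b" using fg(5)[of v "g b"] by (simp only: fg(3))
      moreover have "rk b = j \<or> v \<bullet> g b = 0" using orth[rule_format, OF j rk(1)[OF b] _ v rk(2)[OF b]] by blast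
      ultimately have "rk b = j \<or> f v \<bullet> b = 0" by simp
      then show "D r (f v) \<bullet> b = (r ^ j *\<^sub>R f v) \<bullet> b" by (auto simp: D_inner[OF b])
    qed
    then show "g (D r (f v)) = r ^ j *\<^sub>R v" using fg(2,4) by (simp add: linear_scale)
  qed
  note d_metric = homogeneous_distanceD(1)[OF d] and d_cont = homogeneous_distanceD(2)[OF d]
    and d_hom = homogeneous_distanceD(4)[OF d]
  have cont0: "continuous_on S (d 0)" for S
  proof -
    have "continuous_on S (\<lambda>x. (\<lambda>(x, y). d x y) (0, x))"
      by (rule continuous_on_compose2[OF d_cont]) (auto intro!: continuous_intros)
    then show ?thesis by simp
  qed
  have "e \<in> sphere 0 1" using e by simp
  then obtain x0 where x0: "x0 \<in> sphere 0 1" "\<And>y. y \<in> sphere 0 1 \<Longrightarrow> d 0 x0 \<le> d 0 y"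
    using continuous_attains_inf[OF compact_sphere _ cont0, of 0 1] by blast
  have "x0 \<noteq> 0" using x0 by auto
  then have m: "0 < d 0 x0"
    using Metric_space.nonneg[OF d_metric, of 0 x0] Metric_space.zero[OF d_metric, of 0 x0] by fastforce
  have bound: "norm x \<le> max 1 ((R / d 0 x0) ^ \<iota>)" if x: "d 0 x \<le> R" for x
  proof (cases "norm x \<le> 1")
    case False
    have "\<exists>r. 0 \<le> r \<and> r \<le> 1 \<and> norm (D r (f x)) = 1"
    proof (rule IVT')
      have "D 0 (f x) = 0" using rk(1) by (force simp: D_def intro!: sum.neutral)
      then show "norm (D 0 (f x)) \<le> 1" by simp
      have "D 1 (f x) = f x" by (simp add: D_def euclidean_representation)
      then show "1 \<le> norm (D 1 (f x))" using False by (simp add: norm_f)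
      show "continuous_on {0..1} (\<lambda>r. norm (D r (f x)))"
        unfolding D_def by (intro continuous_intros)
    qed simp
    then obtain r where r: "0 \<le> r" "r \<le> 1" "norm (D r (f x)) = 1" by blast
    have "r \<noteq> 0"
    proof
      assume "r = 0"
      then have "D r (f x) = 0" using rk(1) by (force simp: D_def intro!: sum.neutral)
      with r show False by simp
    qed
    then have r0: "0 < r" using r by simp
    have "dilation V \<iota> r 0 = 0" by (simp add: dil linear_0 fg D_lin)
    then have "d 0 (dilation V \<iota> r x) = r * d 0 x" using d_hom[OF r0, of 0 x] by simp
    moreover have "dilation V \<iota> r x \<in> sphere 0 1" using r by (simp add: dil norm_g)
    ultimately have "d 0 x0 \<le> r * d 0 x" using x0(2) by metis
    also have "\<dots> \<le> r * R" using x r0 by simp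
    finally have le: "d 0 x0 / R \<le> r" using R by (simp add: field_simps)
    \<comment> \<open>For \<open>r \<le> 1\<close> the last layer is contracted most; this is the
      origin of the exponent \<iota> in the bound.\<close>
    have "norm (r ^ \<iota> *\<^sub>R f x) \<le> norm (D r (f x))"
    proof (rule norm_le_componentwise)
      fix b :: 'a assume b: "b \<in> Basis"
      have "r ^ \<iota> \<le> r ^ rk b" using rk(1)[OF b] r by (intro power_decreasing) auto
      then show "\<bar>(r ^ \<iota> *\<^sub>R f x) \<bullet> b\<bar> \<le> \<bar>D r (f x) \<bullet> b\<bar>"
        using r by (simp add: D_inner[OF b] abs_mult mult_right_mono)
    qed
    then have "r ^ \<iota> * norm x \<le> 1" using r by (simp add: norm_f)
    moreover have "(d 0 x0 / R) ^ \<iota> \<le> r ^ \<iota>" using le m R by (intro power_mono) auto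
    ultimately have "(d 0 x0 / R) ^ \<iota> * norm x \<le> 1"
      by (meson mult_right_mono norm_ge_zero order_trans)
    then have "norm x \<le> (R / d 0 x0) ^ \<iota>" using m R by (simp add: power_divide field_simps)
    then show ?thesis by simp
  qed simp
  have "bounded {x. d 0 x \<le> R}"
    unfolding bounded_iff by (intro exI[of _ "max 1 ((R / d 0 x0) ^ \<iota>)"]) (use bound in auto)
  moreover have "closed {x. d 0 x \<le> R}"
    by (intro closed_Collect_le cont0 continuous_on_const)
  ultimately show ?thesis by (simp add: compact_eq_bounded_closed)
qed

end

subsection \<open>The maximal slice\<close>

theorem theorem5p2:
  fixes V :: "nat \<Rightarrow> 'a::euclidean_space set"
    and \<iota> :: nat
    and br :: "'a \<Rightarrow> 'a \<Rightarrow> 'a"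
    and B :: "nat \<Rightarrow> 'a set"
    and d :: "'a \<Rightarrow> 'a \<Rightarrow> real"
    and v :: 'a
  assumes "stratified_group V \<iota> br"
    and "adapted_orthonormal_basis V \<iota> B"
    and "homogeneous_distance V \<iota> br d"
    and "convex (hball d 0 1)"
    and "v \<in> V 1 - {0}"
  shows "beta V \<iota> d v =
    hausdorff_measure (DIM('a) - 1) (vertical_subgroup V \<iota> v \<inter> hball d 0 1)"
proof -
  interpret stratified_group V \<iota> br by fact
  let ?H = "hausdorff_measure (DIM('a) - 1) :: 'a set \<Rightarrow> ennreal"
  have 1: "1 \<in> {1..\<iota>}" using last_layer(1) by simp
  have orth: "\<forall>i\<in>{1..\<iota>}. \<forall>j\<in>{1..\<iota>}. i \<noteq> j \<longrightarrow> (\<forall>x\<in>V i. \<forall>y\<in>V j. x \<bullet> y = 0)"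
    using layers_orthogonal[OF assms(2)] by blast
  define e where "e = v /\<^sub>R norm v"
  have v: "v = norm v *\<^sub>R e" "norm v \<noteq> 0" using assms(5) by (auto simp: e_def)
  have e: "e \<in> V 1" "norm e = 1"
    using assms(5) subspace_layer[of 1] by (auto simp: e_def subspace_scale)
  have N: "vertical_subgroup V \<iota> v = {x. x \<bullet> e = 0}"
  proof -
    have "x \<bullet> v = norm v * (x \<bullet> e)" for x by (metis inner_scaleR_right v(1))
    then have "x \<bullet> v = 0 \<longleftrightarrow> x \<bullet> e = 0" for x using v(2) by simp
    moreover have "v \<in> V 1" using assms(5) by simp
    ultimately show ?thesis using vertical_subgroup_eq[OF orth] by simp
  qed
  obtain f g :: "'a \<Rightarrow> 'a" and rk :: "'a \<Rightarrow> nat" where fg: "linear f" "linear g" "\<And>x. f (g x) = x" "\<And>x. g (f x) = x"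
    "\<And>x y. f x \<bullet> f y = x \<bullet> y" "f e \<in> Basis"
    and rk: "\<And>b. b \<in> Basis \<Longrightarrow> rk b \<in> {1..\<iota>}" "\<And>b. b \<in> Basis \<Longrightarrow> g b \<in> V (rk b)"
    by (rule layers_coordinates[OF orth e]) (rule that; assumption)
  have g_inner: "g x \<bullet> g y = x \<bullet> y" for x y using fg(5)[of "g x" "g y"] by (simp add: fg)
  have fg_inner: "f x \<bullet> y = x \<bullet> g y" for x y using fg(5)[of x "g y"] by (simp add: fg)
  have dist_f: "dist (f x) (f y) = dist x y" for x y
    by (simp add: dist_norm norm_eq_sqrt_inner fg flip: linear_diff[OF fg(1)])
  have dist_g: "dist (g x) (g y) = dist x y" for x y
    using dist_f[of "g x" "g y"] by (simp add: fg)
  have H_f: "?H (f ` E) = ?H E" for E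
    by (rule hausdorff_measure_isometry_image[OF dist_f fg(4) dist_g])
  have cont_f: "continuous_on S f" and cont_g: "continuous_on S g" for S
    using fg by (simp_all add: linear_continuous_on linear_conv_bounded_linear)
  note d_metric = homogeneous_distanceD(1)[OF assms(3)] and d_cont = homogeneous_distanceD(2)[OF assms(3)]
    and d_left = homogeneous_distanceD(3)[OF assms(3)]
  have hball: "hball d z 1 = {y. d z y \<le> 1}" for z
    by (simp add: Metric_space.mcball_def[OF d_metric])
  have bch_0: "bch \<iota> br z 0 = z" for z using bch_multiples[of 1 z 0] by simp
  \<comment> \<open>Left translation by \<open>x\<close> carries the pair (0, - x) to (x,
    0).\<close>
  have sym: "d 0 (- x) = d 0 x" for x
  proof -
    have "d 0 (- x) = d (bch \<iota> br x 0) (bch \<iota> br x (- x))" by (simp only: d_left)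
    also have "\<dots> = d x 0" using bch_multiples[of 1 x "- 1"] by (simp add: bch_0)
    also have "\<dots> = d 0 x" by (rule Metric_space.commute[OF d_metric])
    finally show ?thesis .
  qed
  define K where "K = f ` hball d 0 1"
  have K_iff: "y \<in> K \<longleftrightarrow> d 0 (g y) \<le> 1" for y
    unfolding K_def hball using fg by (metis (mono_tags, lifting) image_iff mem_Collect_eq)
  have K: "compact K" "convex K"
    unfolding K_def
    using homogeneous_ball_compact[OF orth e assms(3), of 1] assms(4) fg
    by (auto simp: hball intro!: compact_continuous_image cont_f convex_linear_image)
  have K_sym: "- x \<in> K" if "x \<in> K" for x
    using that sym[of "g x"] by (simp add: K_iff linear_neg[OF fg(2)])
  have central: "?H (vertical_subgroup V \<iota> v \<inter> hball d 0 1) = ?H {x \<in> K. x \<bullet> f e = 0}"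
  proof -
    have "{x \<in> K. x \<bullet> f e = 0} = f ` (vertical_subgroup V \<iota> v \<inter> hball d 0 1)"
      using fg by (auto simp: K_def N)
    then show ?thesis by (simp only: H_f)
  qed
  have le: "?H (hball d z 1 \<inter> vertical_subgroup V \<iota> v) \<le> ?H (vertical_subgroup V \<iota> v \<inter> hball d 0 1)"
    if z: "z \<in> hball d 0 1" for z
  proof -
    define F where "F = f ` (hball d z 1 \<inter> vertical_subgroup V \<iota> v)"
    define P where "P y = f (bch \<iota> br z (g y))" for y
    have F_iff: "f x \<in> F \<longleftrightarrow> d z x \<le> 1 \<and> x \<bullet> e = 0" for x
      unfolding F_def hball N using fg(4) by (metis (mono_tags, lifting) Int_iff image_iff mem_Collect_eq)
    \<comment> \<open>The terms of degree at least two lie in \<open>tail 2\<close>, orthogonal to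
      the first layer, so heights along \<open>e\<close> add under the group law.\<close>
    have bch_e: "bch \<iota> br z x \<bullet> e = z \<bullet> e + x \<bullet> e" for x
      using inner_tail[OF orth 1 _ e(1) bch_tail_2[of z x]] by (simp add: inner_diff_left inner_left_distrib)
    \<comment> \<open>\<open>P\<close> is left translation by \<open>z\<close> in coordinates and
      raises heights by \<open>z \<bullet> e\<close>; the slice it moves onto the vertical subgroup
      is therefore the one at height \<open>- (z \<bullet> e)\<close>.\<close>
    have "?H F = ?H {x \<in> K. x \<bullet> f e = - (z \<bullet> e)}"
    proof (rule hausdorff_measure_triangular_slice[where rk = rk and P = P])
      show "continuous_on UNIV P"
        unfolding P_def
        by (intro continuous_on_compose2[OF cont_f] continuous_on_compose2[OF continuous_on_bch] cont_g) auto
      show "P x \<bullet> f e = x \<bullet> f e - - (z \<bullet> e)" for x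
        by (simp add: P_def fg bch_e) (metis fg(4) g_inner)
      show "(P (x + s *\<^sub>R c) - (x + s *\<^sub>R c)) \<bullet> b = (P x - x) \<bullet> b"
        if b: "b \<in> Basis - {f e}" and c: "c \<in> Basis - {f e}" and bc: "rk b \<le> rk c" for b c x s
      proof -
        have rkc: "1 \<le> rk c" "rk c \<in> {1..\<iota>}" using rk(1)[of c] c by auto
        \<comment> \<open>\<open>?\<Delta>\<close> is the deviation from a Euclidean translation
          when \<open>x\<close> moves along \<open>c\<close>. It lies strictly above layer
          \<open>rk c\<close>, hence is orthogonal to \<open>g b\<close> because
          \<open>rk b \<le> rk c\<close>.\<close>
        let ?\<Delta> = "bch \<iota> br z (g (x + s *\<^sub>R c)) - bch \<iota> br z (g x) - (g (x + s *\<^sub>R c) - g x)"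
        have "g (x + s *\<^sub>R c) - g x = s *\<^sub>R g c"
          using fg(2) by (simp add: linear_add linear_scale)
        moreover have "s *\<^sub>R g c \<in> tail (rk c)"
          using layer_subset_tail[OF rkc(1) order_refl] rk(2)[of c] c by (auto intro!: subspace_scale)
        ultimately have "?\<Delta> \<in> tail (Suc (rk c))"
          by (intro bch_tail_diff[OF rkc(1)]) simp
        then have "?\<Delta> \<bullet> g b = 0"
          using b bc rk[of b] by (intro inner_tail[OF orth, of "rk b" "Suc (rk c)"]) auto
        moreover have "f ?\<Delta> = P (x + s *\<^sub>R c) - P x - (x + s *\<^sub>R c - x)"
          using fg(3) by (simp add: P_def linear_diff[OF fg(1)])
        ultimately have "(P (x + s *\<^sub>R c) - P x - (x + s *\<^sub>R c - x)) \<bullet> b = 0"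
          using fg_inner[of ?\<Delta> b] by simp
        then show ?thesis by (simp add: inner_diff_left inner_left_distrib)
      qed
      have "compact (hball d z 1 \<inter> vertical_subgroup V \<iota> v)"
      proof -
        have "continuous_on UNIV (\<lambda>x. (\<lambda>(x, y). d x y) (z, x))"
          by (rule continuous_on_compose2[OF d_cont]) (auto intro!: continuous_intros)
        then have "closed {y. d z y \<le> 1}"
          by (intro closed_Collect_le continuous_on_const) simp
        moreover have "closed {x. x \<bullet> e = 0}" by (intro closed_Collect_eq continuous_intros)
        \<comment> \<open>As \<open>z\<close> is within distance 1 of 0, the radius 2 suffices;
          compactness is known for balls centred at 0.\<close>
        moreover have "hball d z 1 \<subseteq> {x. d 0 x \<le> 2}"
        proof
          fix y assume "y \<in> hball d z 1"
          then show "y \<in> {x. d 0 x \<le> 2}"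
            using z Metric_space.triangle[OF d_metric, of 0 z y] by (simp add: hball)
        qed
        moreover have "compact {x. d 0 x \<le> 2}"
          by (rule homogeneous_ball_compact[OF orth e assms(3)]) simp
        ultimately have "compact ({x. d 0 x \<le> 2} \<inter> ({y. d z y \<le> 1} \<inter> {x. x \<bullet> e = 0}))"
          by (intro compact_Int_closed closed_Int)
        moreover have "{x. d 0 x \<le> 2} \<inter> ({y. d z y \<le> 1} \<inter> {x. x \<bullet> e = 0}) = hball d z 1 \<inter> vertical_subgroup V \<iota> v"
          using \<open>hball d z 1 \<subseteq> {x. d 0 x \<le> 2}\<close> by (auto simp: hball N)
        ultimately show ?thesis by simp
      qed
      then show "compact F" unfolding F_def by (intro compact_continuous_image cont_f)
      show "F \<subseteq> {y. y \<bullet> f e = 0}" using fg by (auto simp: F_def N)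
      show "P x \<in> F \<longleftrightarrow> x \<in> K" if "x \<bullet> f e = - (z \<bullet> e)" for x
      proof -
        have "g x \<bullet> e = - (z \<bullet> e)" using that fg_inner[of e x] by (simp add: inner_commute)
        moreover have "d z (bch \<iota> br z (g x)) = d 0 (g x)" using d_left[of z 0 "g x"] by (simp add: bch_0)
        ultimately show ?thesis unfolding P_def F_iff K_iff by (simp add: bch_e)
      qed
    qed (use fg K in auto)
    also have "\<dots> \<le> ?H {x \<in> K. x \<bullet> f e = 0}"
      using K K_sym fg(6) by (rule hausdorff_measure_central_slice_max)
    finally show ?thesis unfolding F_def H_f central .
  qed
  have 0: "0 \<in> hball d 0 1"
    using Metric_space.zero[OF d_metric, of 0 0] by (simp add: hball)
  show ?thesis
    unfolding beta_def
  \<comment> \<open>The bound \<open>le\<close> alone would identify a supremum; the centre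
    \<open>z = 0\<close> attains it, as \<open>GREATEST\<close> requires.\<close>
  proof (rule Greatest_equality)
    show "\<exists>z\<in>hball d 0 1. ?H (vertical_subgroup V \<iota> v \<inter> hball d 0 1) = ?H (hball d z 1 \<inter> vertical_subgroup V \<iota> v)"
      using 0 by (auto simp: Int_commute)
  qed (use le in blast)
qed

end
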